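(* Let $K$ be a quadratic field and $c \in K$. Then the directed graph $G(f_c,K)$ does not contain a subgraph isomorphic to the graph $G_6$.
   Context: For $f_c(z) = z^2 + c$ and a number field $K$, $G(f_c,K)$ is the directed graph whose vertices are the points of $K$ (the point at infinity excluded) that are preperiodic for $f_c$, with an edge $x \to y$ iff $f_c(x) = y$. The graph $G_6$ has twelve vertices $a, a', b, b', s, \bar s, p, q, \bar p, \bar q, r, \bar r$ and edges $a \to a$, $b \to a$, $a' \to a'$, $b' \to a'$, $s \to b$, $\bar s \to b$, $p \to q$, $q \to p$, $\bar p \to q$, $\bar q \to p$, $r \to \bar p$, $\bar r \to \bar p$ (equivalently: two distinct fixed points, a point of preperiodic type $1_2$, and a point of type $2_2$, i.e. preperiod $2$ and eventual period $2$, together with the preimages these force). *)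

theory Defs
  imports Complex_Main "Graph_Theory.Graph_Theory"
begin

text \<open>
  Every field of characteristic 0 is a vector space over the rationals by way of
  \<^const>\<open>of_rat\<close>. A quadratic field is one of dimension 2; note that
  \<^const>\<open>vector_space.dim\<close> is 0 for infinite-dimensional spaces, so dimension 2
  entails the existence of a basis with two elements.
\<close>

lemma vector_space_of_rat:
  "vector_space (\<lambda>(q::rat) (x::'k::field_char_0). of_rat q * x)"
  by unfold_locales (simp_all add: algebra_simps of_rat_add of_rat_mult)

definition quadratic_field :: "'k::field_char_0 itself \<Rightarrow> bool" where
  "quadratic_field _ \<longleftrightarrow>
     vector_space.dim (\<lambda>(q::rat) (x::'k). of_rat q * x) UNIV = 2"

definition quad_map :: "'k::field_char_0 \<Rightarrow> 'k \<Rightarrow> 'k" where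
  "quad_map c z = z ^ 2 + c"

definition preperiodic :: "('a \<Rightarrow> 'a) \<Rightarrow> 'a \<Rightarrow> bool" where
  "preperiodic f x \<longleftrightarrow> (\<exists>m n. n > 0 \<and> (f ^^ (m + n)) x = (f ^^ m) x)"

text \<open>
  The field is the whole type, so the point at infinity is not a vertex. The digraphs may
  have loops but no parallel arcs; an arc is the pair of its tail and its head.
\<close>

definition preperiodic_graph :: "'k::field_char_0 \<Rightarrow> 'k pair_pre_digraph" where
  "preperiodic_graph c =
     \<lparr> pverts = {x. preperiodic (quad_map c) x},
       parcs = {(x, y). preperiodic (quad_map c) x \<and> preperiodic (quad_map c) y \<and>
                        quad_map c x = y} \<rparr>"

datatype G6_vertex = va | va' | vb | vb' | vs | vsbar | vp | vq | vpbar | vqbar | vr | vrbar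

definition G6 :: "G6_vertex pair_pre_digraph" where
  "G6 =
     \<lparr> pverts = {va, va', vb, vb', vs, vsbar, vp, vq, vpbar, vqbar, vr, vrbar},
       parcs = {(va, va), (vb, va), (va', va'), (vb', va'), (vs, vb), (vsbar, vb),
                (vp, vq), (vq, vp), (vpbar, vq), (vqbar, vp), (vr, vpbar), (vrbar, vpbar)} \<rparr>"

definition contains_copy :: "('a, 'b) pre_digraph \<Rightarrow> ('c, 'd) pre_digraph \<Rightarrow> bool" where
  "contains_copy G H \<longleftrightarrow> (\<exists>S. subgraph S G \<and> digraph_iso S H)"

text \<open>
  \<^const>\<open>subgraph\<close> and \<^const>\<open>digraph_iso\<close> both require well-formedness,
  so non-containment would hold vacuously without the following facts.
\<close>

lemma preperiodic_step:
  assumes "preperiodic f x"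
  shows "preperiodic f (f x)"
proof -
  obtain m n where mn: "n > 0" "(f ^^ (m + n)) x = (f ^^ m) x"
    using assms unfolding preperiodic_def by blast
  have "(f ^^ (m + n)) (f x) = f ((f ^^ (m + n)) x)"
    by (simp only: funpow_swap1)
  also have "\<dots> = (f ^^ m) (f x)"
    by (simp only: mn(2) funpow_swap1)
  finally show ?thesis
    using mn(1) unfolding preperiodic_def by blast
qed

lemma preperiodic_graph_arcs:
  "parcs (preperiodic_graph c) = {(x, quad_map c x) | x. preperiodic (quad_map c) x}"
  by (auto simp: preperiodic_graph_def intro: preperiodic_step)

lemma wf_preperiodic_graph: "wf_digraph (with_proj (preperiodic_graph c))"
  by unfold_locales (auto simp: preperiodic_graph_def)

lemma wf_G6: "wf_digraph (with_proj G6)"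
  by unfold_locales (auto simp: G6_def)

text \<open>Containing a copy amounts to an injective, arc-preserving map on the vertices.\<close>

lemma contains_copy_with_proj_iff:
  assumes G: "wf_digraph (with_proj G)" and H: "wf_digraph (with_proj H)"
  shows "contains_copy (with_proj G) (with_proj H) \<longleftrightarrow>
    (\<exists>h. inj_on h (pverts H) \<and> h ` pverts H \<subseteq> pverts G \<and>
         (\<forall>(u, v) \<in> parcs H. (h u, h v) \<in> parcs G))"
proof
  assume "contains_copy (with_proj G) (with_proj H)"
  then obtain S f where S: "subgraph S (with_proj G)"
    and f: "pre_digraph.digraph_isomorphism S f" and H_eq: "with_proj H = app_iso f S"
    unfolding contains_copy_def digraph_iso_def by blast
  have V: "pverts H = iso_verts f ` verts S" and A: "parcs H = iso_arcs f ` arcs S"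
    and T: "fst = iso_tail f" "snd = iso_head f"
    using H_eq by (auto simp: with_proj_def app_iso_def)
  have sub: "verts S \<subseteq> pverts G" "arcs S \<subseteq> parcs G" "tail S = fst" "head S = snd"
    and wfS: "wf_digraph S"
    using S by (auto simp: subgraph_def compatible_def)
  have inj: "inj_on (iso_verts f) (verts S)"
    and ends: "\<And>a. a \<in> arcs S \<Longrightarrow> iso_verts f (fst a) = fst (iso_arcs f a) \<and>
                                   iso_verts f (snd a) = snd (iso_arcs f a)"
    using f by (auto simp: pre_digraph.digraph_isomorphism_def sub T)
  let ?h = "the_inv_into (verts S) (iso_verts f)"
  have "inj_on ?h (pverts H)"
    unfolding V by (rule inj_on_the_inv_into[OF inj])
  moreover have "?h ` pverts H \<subseteq> pverts G"
    using sub(1) by (auto simp: V the_inv_into_f_f[OF inj])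
  moreover have "(?h u, ?h v) \<in> parcs G" if uv: "(u, v) \<in> parcs H" for u v
  proof -
    obtain x y where xy: "(x, y) \<in> arcs S" "iso_arcs f (x, y) = (u, v)"
      using uv unfolding A by force
    have "x \<in> verts S" "y \<in> verts S"
      using wf_digraph.wellformed[OF wfS xy(1)] by (simp_all add: sub)
    moreover have "iso_verts f x = u" "iso_verts f y = v"
      using ends[OF xy(1)] xy(2) by simp_all
    ultimately have "?h u = x" "?h v = y"
      using the_inv_into_f_f[OF inj] by blast+
    then show ?thesis using xy(1) sub(2) by auto
  qed
  ultimately show "\<exists>h. inj_on h (pverts H) \<and> h ` pverts H \<subseteq> pverts G \<and>
      (\<forall>(u, v) \<in> parcs H. (h u, h v) \<in> parcs G)"
    by blast
next
  assume "\<exists>h. inj_on h (pverts H) \<and> h ` pverts H \<subseteq> pverts G \<and>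
      (\<forall>(u, v) \<in> parcs H. (h u, h v) \<in> parcs G)"
  then obtain h where h: "inj_on h (pverts H)" "h ` pverts H \<subseteq> pverts G"
      "\<forall>(u, v) \<in> parcs H. (h u, h v) \<in> parcs G"
    by metis
  have ends: "fst a \<in> pverts H" "snd a \<in> pverts H" if "a \<in> parcs H" for a
    using wf_digraph.wellformed[OF H, of a] that by simp_all
  let ?f = "\<lparr> iso_verts = h, iso_arcs = map_prod h h, iso_head = snd, iso_tail = fst \<rparr>"
  let ?S = "app_iso ?f (with_proj H)"
  have inj: "inj_on (map_prod h h) (parcs H)"
  proof (rule inj_onI)
    fix x y assume xy: "x \<in> parcs H" "y \<in> parcs H" "map_prod h h x = map_prod h h y"
    then have "h (fst x) = h (fst y)" "h (snd x) = h (snd y)"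
      by (metis fst_map_prod, metis snd_map_prod)
    then show "x = y"
      using inj_onD[OF h(1)] ends[OF xy(1)] ends[OF xy(2)] by (simp add: prod_eq_iff)
  qed
  have iso: "pre_digraph.digraph_isomorphism (with_proj H) ?f"
    using H h(1) inj by (simp add: pre_digraph.digraph_isomorphism_def)
  have "wf_digraph ?S"
    by (rule wf_digraph.wf_digraphI_app_iso[OF H iso])
  then have "subgraph ?S (with_proj G)"
    using G h(2,3) by (force simp: subgraph_def compatible_def)
  moreover have "digraph_iso ?S (with_proj H)"
    unfolding digraph_iso_def
    using wf_digraph.digraph_isomorphism_invI[OF H iso] pre_digraph.app_iso_inv[OF iso]
    by (intro exI conjI) (assumption, rule sym)
  ultimately show "contains_copy (with_proj G) (with_proj H)"
    unfolding contains_copy_def by blast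
qed

end

theory Submission
  imports Defs "HOL-Computational_Algebra.Nth_Powers"
begin

text \<open>
  A copy of \<open>G6\<close> forces \<open>b = -a\<close>, \<open>q = -p - 1\<close>, and the preimage \<open>-p\<close> of \<open>q\<close>. With \<open>t = a + p\<close>
  one has \<open>1/t = a - p - 1\<close>, and the preimages \<open>s\<close> of \<open>-a\<close> and \<open>r\<close> of \<open>-p\<close> give
  \<open>(2ts)\<^sup>2 = t\<^sup>4 - 2t\<^sup>3 - t\<^sup>2 - 2t + 1\<close> and \<open>(2tr)\<^sup>2 = t\<^sup>4 - 2t\<^sup>3 + 3t\<^sup>2 + 2t + 1\<close>: a point over \<open>K\<close>
  on a curve of genus 5 covering two elliptic curves of rank 0. Infinite descent shows that the
  rational points of both quartics lie over \<open>t = 0\<close> or at infinity. If \<open>t\<close> is irrational, the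
  parabola \<open>y = t\<^sup>2 + \<alpha>t + \<beta>\<close> through a point and its conjugate meets the quartic in one further
  rational point; knowing that point leaves for the trace and norm of \<open>t\<close> a short list of
  relations, and those of the two quartics are incompatible. If \<open>t\<close> is rational, either one of the
  quartics takes a rational square at \<open>t\<close>, or both values lie in the same square class \<open>d\<close>; a common
  prime factor can only be 5, so \<open>d = 5\<close>, and a descent on the twist by 5 leaves only \<open>t = -1\<close>,
  where \<open>p = q\<close>.
\<close>

subsection \<open>Coprime factors of squares\<close>

lemma coprime_int_primeI:
  fixes x y :: int
  assumes "\<And>p. prime p \<Longrightarrow> p dvd x \<Longrightarrow> p dvd y \<Longrightarrow> False"
  shows "coprime x y"
proof (rule ccontr)
  assume "\<not> coprime x y"
  then have "\<bar>gcd x y\<bar> \<noteq> 1" by (simp add: coprime_iff_gcd_eq_1)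
  then obtain p where "prime p" "p dvd gcd x y" using prime_factor_int by blast
  then show False using assms[of p] by simp
qed

lemma coprime_mult_eq_square:
  fixes x y z :: int
  assumes "coprime x y" "x \<ge> 0" "y \<ge> 0" "x * y = z\<^sup>2"
  obtains r s where "x = r\<^sup>2" "y = s\<^sup>2" "z = r * s"
proof -
  have "nat x * nat y = (nat \<bar>z\<bar>)^2"
    using assms by (metis nat_mult_distrib nat_power_eq power2_abs abs_ge_zero)
  moreover have "coprime (nat x) (nat y)"
    using assms by (metis coprime_int_iff int_nat_eq)
  ultimately have "is_nth_power 2 (nat x)" "is_nth_power 2 (nat y)"
    using is_nth_power_mult_coprime_nat_iff[of "nat x" "nat y" 2] by auto
  then obtain r s where "nat x = r\<^sup>2" "nat y = s\<^sup>2" by (auto elim!: is_nth_powerE)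
  then have x: "x = (int r)\<^sup>2" and y: "y = (int s)\<^sup>2"
    using assms by (metis int_nat_eq of_nat_power)+
  then have "z\<^sup>2 = (int r * int s)\<^sup>2" using assms by (simp add: power_mult_distrib)
  then consider "z = int r * int s" | "z = int r * (- int s)" by (auto simp: power2_eq_iff)
  then show thesis
    using x y by cases (auto intro: that[of "int r" "int s"] that[of "int r" "- int s"])
qed

text \<open>Take \<open>e\<close> to be the gcd of \<open>a\<close> and \<open>x\<close>. The
  cofactors \<open>f\<close> and \<open>g\<close> are coprime, so \<open>f\<close> divides
  \<open>y\<close>, and the remaining factor is \<open>h\<close>.\<close>

lemma four_number:
  fixes a d x y :: int
  assumes "a * d = x * y" "a \<noteq> 0"
  obtains e f g h where "a = e * f" "d = g * h" "x = e * g" "y = f * h" "coprime f g"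
proof -
  obtain f g where fg: "a = gcd a x * f" "x = gcd a x * g" "coprime f g"
    using assms(2) by (metis gcd_coprime_exists gcd_eq_0_iff mult.commute)
  have e: "gcd a x \<noteq> 0" using assms(2) by simp
  have "gcd a x * (f * d) = gcd a x * (g * y)"
    using assms(1) fg by (metis mult.assoc)
  then have eq: "f * d = g * y" using e by (metis mult_left_cancel)
  then have "f dvd y" using fg(3) by (metis coprime_dvd_mult_right_iff dvd_triv_left)
  then obtain h where h: "y = f * h" by blast
  have "f \<noteq> 0" using fg assms by auto
  then have "d = g * h" using eq h by simp
  then show thesis using that fg h by blast
qed

text \<open>The 5-adic valuation would be even on the left and odd on the right.\<close>

lemma square_eq_5_square:
  fixes x y :: int
  assumes "x\<^sup>2 = 5 * y\<^sup>2"
  shows "y = 0"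
proof (rule ccontr)
  assume y: "y \<noteq> 0"
  have "prime (5::int)" by simp
  then have "multiplicity 5 (x\<^sup>2) = 2 * multiplicity 5 x"
    using assms y by (subst prime_elem_multiplicity_power_distrib) auto
  moreover have "multiplicity 5 (5 * y\<^sup>2) = 1 + 2 * multiplicity 5 y"
    using y by (subst prime_elem_multiplicity_mult_distrib, simp_all add: prime_elem_multiplicity_power_distrib multiplicity_same_power)
  ultimately have "2 * multiplicity 5 x = Suc (2 * multiplicity 5 y)"
    using assms by simp
  then show False by presburger
qed

subsection \<open>Descent on two intersections of quadrics\<close>

text \<open>
  If \<open>a\<^sup>2 + 4(b - c)\<^sup>2\<close> is 5 times a square, then by this identity its image under
  \<open>(a, b, c, d) \<mapsto> (b, a, d, c)\<close> is not. Hence one of the two leads to a descent step.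
\<close>

lemma norm_product_identity:
  fixes a b c d :: int
  assumes "a\<^sup>2 - d\<^sup>2 = b * c" "b\<^sup>2 - c\<^sup>2 = a * d"
  shows "(a\<^sup>2 + 4 * (b - c)\<^sup>2) * (b\<^sup>2 + 4 * (a - d)\<^sup>2) = 5 * (a*b - 2*a*c - 2*b*d + 2*c*d)\<^sup>2"
  using assms by algebra

text \<open>The four numbers come from a d = (b - c)(b + c). Writing 4 b c as a difference of
  squares turns the first quadric into h^2 (f^2 - 4 s g^2) = e^2 (4 f^2 + g^2), and since
  \<open>e\<close> and \<open>h\<close> are coprime there is a common cofactor \<open>k\<close>.
  Eliminating \<open>g\<close> or \<open>f\<close> between the two forms shows that \<open>k\<close>
  divides 16 s + 1 times f^2 and g^2, which are coprime.\<close>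

lemma quadric_split:
  fixes a b c d s :: int
  assumes "coprime a d" "a\<^sup>2 + s * d\<^sup>2 = b * c" "b\<^sup>2 - c\<^sup>2 = a * d"
    and "a \<noteq> 0" "d \<noteq> 0"
  obtains e f g h k where "a = e * f" "d = g * h" "b - c = e * g" "coprime f g" "coprime e h"
    "4 * f\<^sup>2 + g\<^sup>2 = k * h\<^sup>2" "f\<^sup>2 - 4 * s * g\<^sup>2 = k * e\<^sup>2" "k > 0" "k dvd 16 * s + 1"
proof -
  have "a * d = (b - c) * (b + c)"
    using assms(3) by (simp add: power2_eq_square algebra_simps)
  then obtain e f g h where
    efgh: "a = e * f" "d = g * h" "b - c = e * g" "b + c = f * h" "coprime f g"
    using four_number assms(4) by metis
  have eh: "coprime e h" using assms(1) efgh by simp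
  have nz: "e \<noteq> 0" "f \<noteq> 0" "g \<noteq> 0" "h \<noteq> 0" using assms efgh by auto
  have "4 * (b * c) = (f * h)\<^sup>2 - (e * g)\<^sup>2"
    unfolding efgh(3,4)[symmetric] by (simp add: power2_eq_square algebra_simps)
  then have eq: "h\<^sup>2 * (f\<^sup>2 - 4 * s * g\<^sup>2) = e\<^sup>2 * (4 * f\<^sup>2 + g\<^sup>2)"
    unfolding assms(2)[symmetric] efgh(1,2) by (simp add: power2_eq_square algebra_simps)
  have "h\<^sup>2 dvd e\<^sup>2 * (4 * f\<^sup>2 + g\<^sup>2)" using eq by (metis dvd_triv_left)
  then have "h\<^sup>2 dvd 4 * f\<^sup>2 + g\<^sup>2"
    using eh by (metis coprime_dvd_mult_right_iff coprime_commute coprime_power_left_iff coprime_power_right_iff)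
  then obtain k where k: "4 * f\<^sup>2 + g\<^sup>2 = k * h\<^sup>2" by (metis dvdE mult.commute)
  then have "h\<^sup>2 * (f\<^sup>2 - 4 * s * g\<^sup>2) = h\<^sup>2 * (k * e\<^sup>2)" using eq by (simp add: algebra_simps)
  then have k': "f\<^sup>2 - 4 * s * g\<^sup>2 = k * e\<^sup>2" using nz by simp
  have "k * h\<^sup>2 > 0" using nz k by (metis add_nonneg_pos zero_le_power2 zero_less_power2 mult_nonneg_nonneg zero_le_numeral)
  then have "k > 0" by (simp add: zero_less_mult_iff)
  have "(16 * s + 1) * f\<^sup>2 = k * (4 * s * h\<^sup>2 + e\<^sup>2)"
    "(16 * s + 1) * g\<^sup>2 = k * (h\<^sup>2 - 4 * e\<^sup>2)"
    using k k' by algebra+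
  then have "k dvd (16 * s + 1) * f\<^sup>2" "k dvd (16 * s + 1) * g\<^sup>2"
    by (metis dvd_triv_left)+
  then have "k dvd gcd ((16 * s + 1) * f\<^sup>2) ((16 * s + 1) * g\<^sup>2)" by (rule gcd_greatest)
  also have "\<dots> = \<bar>16 * s + 1\<bar>"
    using efgh(5) by (simp add: gcd_mult_distrib_int[symmetric])
  finally have "k dvd 16 * s + 1" by simp
  then show thesis using that efgh eh k k' \<open>k > 0\<close> by blast
qed

text \<open>The halves of z + n and z - n are coprime, non-negative and have the product g^2, so
  both are squares.\<close>

lemma pythagorean_split:
  fixes z n g :: int
  assumes "z\<^sup>2 = n\<^sup>2 + 4 * g\<^sup>2" "coprime n g" "z \<ge> 0"
  obtains x y where "z = x\<^sup>2 + y\<^sup>2" "n = x\<^sup>2 - y\<^sup>2" "g = x * y"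
proof -
  have "even z = even n" using assms(1) by (metis even_add even_mult_iff even_numeral even_power pos2)
  then obtain u v where uv: "z + n = 2 * u" "z - n = 2 * v"
    by (metis dvdE even_add even_diff)
  then have zn: "z = u + v" "n = u - v" by auto
  have prod: "u * v = g\<^sup>2" using assms(1) unfolding zn by (simp add: power2_eq_square algebra_simps)
  have "coprime u v"
  proof (rule coprime_int_primeI)
    fix p :: int assume p: "prime p" "p dvd u" "p dvd v"
    then have "p dvd n" "p dvd g\<^sup>2" unfolding zn prod[symmetric] by auto
    then have "p dvd g" using p by (meson prime_dvd_power)
    then show False using \<open>p dvd n\<close> assms(2) p by (meson coprime_common_divisor not_prime_unit)
  qed
  have "n\<^sup>2 \<le> z\<^sup>2" using assms(1) by simp
  then have "\<bar>n\<bar> \<le> z" using assms(3) by (simp add: abs_le_square_iff[symmetric])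
  then have "u \<ge> 0" "v \<ge> 0" using uv by auto
  then obtain x y where "u = x\<^sup>2" "v = y\<^sup>2" "g = x * y"
    using coprime_mult_eq_square[OF \<open>coprime u v\<close> _ _ prod] by metis
  then show thesis using that zn by auto
qed

lemma dvd_17: fixes k :: int assumes "k dvd 17" "k > 0" shows "k = 1 \<or> k = 17"
proof -
  have "prime (17::int)" by simp
  then show ?thesis using assms by (metis prime_int_iff less_imp_le)
qed

lemma dvd_15: fixes k :: int assumes "k dvd 15" "k > 0" shows "k \<in> {1,3,5,15}"
proof -
  have "k \<le> 15" using assms zdvd_imp_le by force
  then have "k \<in> {1..15}" using assms by simp
  also have "{1..15::int} = {1,2,3,4,5,6,7,8,9,10,11,12,13,14,15}" by (simp add: simp_from_to)
  finally show ?thesis using assms(1) by auto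
qed

text \<open>A prime dividing \<open>u\<close> or \<open>v\<close> and the form also divides the
  square of the other variable, because the outer coefficients are units.\<close>

lemma prime_dvd_form:
  fixes p u v :: int
  assumes "prime p" "coprime u v" "p dvd u * v" "p dvd u\<^sup>2 + k * (u * v) + l * v\<^sup>2" "\<bar>l\<bar> = 1"
  shows False
proof -
  have "p dvd (u\<^sup>2 + k * (u * v) + l * v\<^sup>2) - k * (u * v)" using assms by (intro dvd_diff) auto
  then have *: "p dvd u\<^sup>2 + l * v\<^sup>2" by simp
  have "p dvd u \<and> p dvd v"
  proof (cases "p dvd u")
    case True
    then have "p dvd l * v\<^sup>2" using * by (simp add: dvd_add_right_iff power2_eq_square)
    then have "p dvd \<bar>l\<bar> * v\<^sup>2" by (cases "l \<ge> 0") auto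
    then show ?thesis using True assms(1,5) by (auto dest: prime_dvd_power)
  next
    case False
    then have "p dvd v" using assms by (simp add: prime_dvd_mult_iff)
    then have "p dvd u\<^sup>2" using * by (simp add: dvd_add_left_iff power2_eq_square)
    then show ?thesis using \<open>p dvd v\<close> assms(1) by (auto dest: prime_dvd_power)
  qed
  then show False using assms(1,2) by (meson coprime_common_divisor not_prime_unit)
qed

lemma coprime_prod_form:
  fixes u v :: int
  assumes "coprime u v" "\<bar>l\<bar> = 1"
  shows "coprime (u * v) (u\<^sup>2 + k * (u * v) + l * v\<^sup>2)"
  using assms prime_dvd_form by (blast intro: coprime_int_primeI)

text \<open>This closes the descents: splitting the Pythagorean triple with legs x y and 2 (x^2 + s
  y^2) returns a point on the same pair of quadrics.\<close>

lemma sum_quadric_step: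
  fixes x y h :: int
  assumes "coprime x y" "h\<^sup>2 = 4 * (x\<^sup>2 + s * y\<^sup>2)\<^sup>2 + (x * y)\<^sup>2" "\<bar>s\<bar> = 1"
  obtains b c where "x\<^sup>2 + s * y\<^sup>2 = b * c" "b\<^sup>2 - c\<^sup>2 = x * y"
proof -
  have "coprime (x * y) (x\<^sup>2 + s * y\<^sup>2)" using coprime_prod_form[of x y s 0] assms by simp
  then obtain b c where "\<bar>h\<bar> = b\<^sup>2 + c\<^sup>2" "x * y = b\<^sup>2 - c\<^sup>2" "x\<^sup>2 + s * y\<^sup>2 = b * c"
    using pythagorean_split[of "\<bar>h\<bar>" "x * y" "x\<^sup>2 + s * y\<^sup>2"] assms(2) by (auto simp: add.commute)
  then show thesis using that by simp
qed

text \<open>Infinite descent on the absolute value of a d. After \<open>quadric_split\<close> the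
  cofactor is 1 or 17, and the second case reduces to the first. One Pythagorean split and
  \<open>sum_quadric_step\<close> then give a solution whose product x y is the single factor
  \<open>g'\<close> of a d.\<close>

lemma no_sum_quadric:
  fixes a b c d :: int
  assumes "coprime a d" "a\<^sup>2 + d\<^sup>2 = b * c" "b\<^sup>2 - c\<^sup>2 = a * d"
  shows "a * d = 0"
  using assms
proof (induction "nat \<bar>a * d\<bar>" arbitrary: a b c d rule: less_induct)
  case less
  show ?case
  proof (rule ccontr)
    assume "a * d \<noteq> 0"
    then have "a \<noteq> 0" "d \<noteq> 0" by auto
    obtain e f g h k where efgh: "a = e * f" "d = g * h" "coprime f g" "coprime e h"
      "4 * f\<^sup>2 + g\<^sup>2 = k * h\<^sup>2" "f\<^sup>2 - 4 * g\<^sup>2 = k * e\<^sup>2" "k > 0" "k dvd 17"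
      using quadric_split[of a d 1 b c, simplified] less.prems \<open>a \<noteq> 0\<close> \<open>d \<noteq> 0\<close> by metis
    obtain e' f' g' h' where 1: "f'\<^sup>2 - 4 * g'\<^sup>2 = e'\<^sup>2" "4 * f'\<^sup>2 + g'\<^sup>2 = h'\<^sup>2" "coprime f' g'"
      "e' * f' * g' * h' = a * d"
    proof (cases "k = 1")
      case True
      then show thesis using efgh by (intro that[of f g e h]) (auto simp: algebra_simps)
    next
      case False
      then have "k = 17" using dvd_17 efgh by blast
      \<comment> \<open>Solving the two equations for f^2 and g^2 cancels 17. The result is the
        system for k = 1 with (f, g, e, h) replaced by (h, e, g, f).\<close>
      then have "h\<^sup>2 - 4 * e\<^sup>2 = g\<^sup>2" "4 * h\<^sup>2 + e\<^sup>2 = f\<^sup>2"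
        using efgh by auto
      then show thesis using efgh by (intro that[of h e g f]) (auto simp: algebra_simps coprime_commute)
    qed
    have nz: "e' \<noteq> 0" "f' \<noteq> 0" "g' \<noteq> 0" "h' \<noteq> 0" using 1(4) \<open>a * d \<noteq> 0\<close> by auto
    have cop: "coprime e' g'"
    proof (rule coprime_int_primeI)
      fix p :: int assume p: "prime p" "p dvd e'" "p dvd g'"
      then have "p dvd e'\<^sup>2 + 4 * g'\<^sup>2" by (simp add: power2_eq_square)
      then have "p dvd f'\<^sup>2" using 1(1) by (simp add: algebra_simps)
      then have "p dvd f'" using p by (meson prime_dvd_power)
      then show False using 1(3) p by (meson coprime_common_divisor not_prime_unit)
    qed
    have "\<bar>f'\<bar>\<^sup>2 = e'\<^sup>2 + 4 * g'\<^sup>2" using 1(1) by simp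
    then obtain x y where xy: "\<bar>f'\<bar> = x\<^sup>2 + y\<^sup>2" "g' = x * y"
      using pythagorean_split cop abs_ge_zero by metis
    have "coprime x y"
    proof (rule coprime_int_primeI)
      fix p :: int assume p: "prime p" "p dvd x" "p dvd y"
      then have "p dvd \<bar>f'\<bar>" "p dvd g'" unfolding xy by (simp_all add: power2_eq_square)
      then show False using 1(3) p by (meson coprime_common_divisor not_prime_unit dvd_abs_iff)
    qed
    moreover have "h'\<^sup>2 = 4 * (x\<^sup>2 + 1 * y\<^sup>2)\<^sup>2 + (x * y)\<^sup>2"
      using 1(2) xy by (metis mult_1 power2_abs)
    ultimately obtain b' c' where bc: "x\<^sup>2 + y\<^sup>2 = b' * c'" "b'\<^sup>2 - c'\<^sup>2 = x * y"
      using sum_quadric_step[of x y h' 1] by auto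
    \<comment> \<open>Strict decrease: f'^2 is a sum of two positive terms, so the factor
      \<open>f'\<close> dropped from the product is not a unit.\<close>
    have "\<bar>f'\<bar> > 1"
    proof -
      have "e'\<^sup>2 > 0" "g'\<^sup>2 > 0" using nz by auto
      then have "f'\<^sup>2 > 1" using 1(1) by linarith
      then have "\<bar>f'\<bar>\<^sup>2 > 1\<^sup>2" by simp
      then show ?thesis by (rule power_less_imp_less_base) simp
    qed
    moreover have "\<bar>e' * h'\<bar> \<ge> 1" using nz by (simp add: abs_mult int_one_le_iff_zero_less)
    ultimately have "1 < \<bar>f'\<bar> * \<bar>e' * h'\<bar>" by (rule less_1_mult')
    then have "\<bar>g'\<bar> * 1 < \<bar>g'\<bar> * (\<bar>f'\<bar> * \<bar>e' * h'\<bar>)"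
      using nz by (intro mult_strict_left_mono) auto
    then have "\<bar>g'\<bar> < \<bar>e' * f' * g' * h'\<bar>" by (simp add: abs_mult mult_ac)
    then have "nat \<bar>x * y\<bar> < nat \<bar>a * d\<bar>"
      using 1(4) xy \<open>a * d \<noteq> 0\<close> by (metis zless_nat_conj zero_less_abs_iff)
    then have "x * y = 0" using less.hyps \<open>coprime x y\<close> bc by blast
    then show False using nz xy by simp
  qed
qed

section \<open>Descent on a^2 - d^2 = b c, b^2 - c^2 = a d\<close>

lemma square_mod_3: "(x::int)\<^sup>2 mod 3 = (if 3 dvd x then 0 else 1)"
proof -
  have sq: "x\<^sup>2 mod 3 = (x mod 3)\<^sup>2 mod 3" by (rule power_mod[symmetric])
  have "x mod 3 = 0 \<or> x mod 3 = 1 \<or> x mod 3 = 2" by presburger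
  then show ?thesis
    unfolding sq dvd_eq_mod_eq_0 by (elim disjE) (simp_all only:, simp_all)
qed

lemma three_dvd_sum_squares:
  fixes x y :: int
  assumes "3 dvd x\<^sup>2 + 4 * y\<^sup>2"
  shows "3 dvd x \<and> 3 dvd y"
proof -
  \<comment> \<open>Stated for \<open>u\<close>, \<open>v\<close> in place of the squares, so that
    the claim is linear.\<close>
  have mod_3: "u mod 3 = 0 \<and> v mod 3 = 0"
    if "3 dvd u + 4 * v" "u mod 3 = 0 \<or> u mod 3 = 1" "v mod 3 = 0 \<or> v mod 3 = 1" for u v :: int
    using that by presburger
  have "x\<^sup>2 mod 3 = 0 \<and> y\<^sup>2 mod 3 = 0"
    using assms by (rule mod_3) (simp_all add: square_mod_3)
  then show ?thesis by (simp_all add: square_mod_3 split: if_splits)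
qed

text \<open>Here \<open>k\<close> divides 15. A factor 3 is impossible because f^2 + 4 g^2 has no
  nontrivial zero modulo 3. The value 1 gives the system for the descent; the value 5 is recorded as
  the second alternative and is dealt with later through
  \<open>norm_product_identity\<close>.\<close>

lemma diff_quadric_split:
  fixes a b c d :: int
  assumes "coprime a d" "a\<^sup>2 - d\<^sup>2 = b * c" "b\<^sup>2 - c\<^sup>2 = a * d" "a \<noteq> 0" "d \<noteq> 0"
  obtains e f g h where "a = e * f" "d = g * h" "coprime f g"
    "4 * f\<^sup>2 + g\<^sup>2 = h\<^sup>2" "f\<^sup>2 + 4 * g\<^sup>2 = e\<^sup>2"
  | e where "e \<noteq> 0" "a\<^sup>2 + 4 * (b - c)\<^sup>2 = 5 * (e\<^sup>2)\<^sup>2"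
proof -
  obtain e f g h k where efgh: "a = e * f" "d = g * h" "b - c = e * g" "coprime f g"
    "4 * f\<^sup>2 + g\<^sup>2 = k * h\<^sup>2" "f\<^sup>2 + 4 * g\<^sup>2 = k * e\<^sup>2" "k > 0" "k dvd 15"
    using quadric_split[of a d "-1" b c, simplified] assms by metis
  have "\<not> 3 dvd k"
  proof
    assume "3 dvd k"
    then have "3 dvd f\<^sup>2 + 4 * g\<^sup>2" using efgh by simp
    then have "3 dvd f" "3 dvd g" using three_dvd_sum_squares by blast+
    then have "is_unit (3::int)" using efgh(4) coprime_common_divisor by blast
    then show False by simp
  qed
  then have "k = 1 \<or> k = 5" using dvd_15[OF efgh(8,7)] by auto
  then show thesis
  proof
    assume "k = 1"
    then show thesis using efgh that(1)[of e f g h] by simp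
  next
    assume "k = 5"
    have "a\<^sup>2 + 4 * (b - c)\<^sup>2 = e\<^sup>2 * (f\<^sup>2 + 4 * g\<^sup>2)"
      unfolding efgh(1,3) by (simp add: power2_eq_square algebra_simps)
    also have "\<dots> = 5 * (e\<^sup>2)\<^sup>2"
      unfolding efgh(6) \<open>k = 5\<close> by (simp add: power2_eq_square)
    finally show thesis using that(2)[of e] assms(4) efgh(1) by auto
  qed
qed

text \<open>Two Pythagorean splits in succession: the equation for e^2 yields f = x^2 - y^2 and g =
  x y, after which the equation for h^2 has the shape of \<open>sum_quadric_step\<close> with s =
  -1.\<close>

lemma diff_quadric_descent:
  fixes e f g h :: int
  assumes "coprime f g" "4 * f\<^sup>2 + g\<^sup>2 = h\<^sup>2" "f\<^sup>2 + 4 * g\<^sup>2 = e\<^sup>2"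
  obtains x y b c where "coprime x y" "x\<^sup>2 - y\<^sup>2 = b * c" "b\<^sup>2 - c\<^sup>2 = x * y" "x * y = g" "b * c = f"
proof -
  obtain x y where xy: "f = x\<^sup>2 - y\<^sup>2" "g = x * y"
    by (rule pythagorean_split[of "\<bar>e\<bar>" f g]) (use assms in auto)
  have cop: "coprime x y"
  proof (rule coprime_int_primeI)
    fix p :: int assume p: "prime p" "p dvd x" "p dvd y"
    then have "p dvd f" "p dvd g" unfolding xy by (simp_all add: power2_eq_square)
    then show False using assms(1) p by (meson coprime_common_divisor not_prime_unit)
  qed
  moreover have "h\<^sup>2 = 4 * (x\<^sup>2 + (- 1) * y\<^sup>2)\<^sup>2 + (x * y)\<^sup>2" using assms(2) unfolding xy by simp
  ultimately obtain b c where bc: "x\<^sup>2 + (- 1) * y\<^sup>2 = b * c" "b\<^sup>2 - c\<^sup>2 = x * y"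
    by (rule sum_quadric_step) simp_all
  show thesis by (rule that[OF cop _ bc(2)]) (use bc xy in simp_all)
qed

text \<open>Infinite descent on the product of all four coordinates; the solution (1, 1, 0, 1) shows
  that a d alone need not vanish. The system is invariant under (a, b, c, d) -> (b, a, d, c), and
  the class 5 cannot occur both for a solution and for its image.\<close>

lemma no_diff_quadric:
  fixes a b c d :: int
  assumes "coprime a d" "a\<^sup>2 - d\<^sup>2 = b * c" "b\<^sup>2 - c\<^sup>2 = a * d"
  shows "a * b * c * d = 0"
  using assms
proof (induction "nat \<bar>a * b * c * d\<bar>" arbitrary: a b c d rule: less_induct)
  case less
  \<comment> \<open>The factor \<open>m\<close> stands for the product of the two coordinates that
    are not split, b c or a d, so that one step serves both tuples.\<close>
  have descent: False if eqs: "coprime f g" "4 * f\<^sup>2 + g\<^sup>2 = h\<^sup>2" "f\<^sup>2 + 4 * g\<^sup>2 = e\<^sup>2"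
    and prod: "a * b * c * d = (e * f) * (g * h) * m" "m \<noteq> 0" and abcd: "a * b * c * d \<noteq> 0"
  for e f g h m
  proof -
    obtain x y b' c' where xy: "coprime x y" "x\<^sup>2 - y\<^sup>2 = b' * c'" "b'\<^sup>2 - c'\<^sup>2 = x * y"
      "x * y = g" "b' * c' = f"
      by (rule diff_quadric_descent[OF eqs])
    have nz: "e \<noteq> 0" "f \<noteq> 0" "g \<noteq> 0" "h \<noteq> 0" using abcd prod by auto
    have "\<bar>e\<bar> > 1"
    proof -
      have "f\<^sup>2 > 0" "g\<^sup>2 > 0" using nz by auto
      then have "e\<^sup>2 > 1" using eqs(3) by linarith
      then have "\<bar>e\<bar>\<^sup>2 > 1\<^sup>2" by simp
      then show ?thesis by (rule power_less_imp_less_base) simp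
    qed
    moreover have "\<bar>h * m\<bar> \<ge> 1" using nz prod(2) by (simp add: abs_mult int_one_le_iff_zero_less)
    ultimately have "1 < \<bar>e\<bar> * \<bar>h * m\<bar>" by (rule less_1_mult')
    then have "\<bar>f * g\<bar> * 1 < \<bar>f * g\<bar> * (\<bar>e\<bar> * \<bar>h * m\<bar>)"
      using nz by (intro mult_strict_left_mono) auto
    also have "\<dots> = \<bar>a * b * c * d\<bar>" unfolding prod by (simp add: abs_mult)
    finally have "\<bar>x * b' * c' * y\<bar> < \<bar>a * b * c * d\<bar>"
      unfolding xy(4,5)[symmetric] by (simp add: mult_ac)
    then have "nat \<bar>x * b' * c' * y\<bar> < nat \<bar>a * b * c * d\<bar>" by linarith
    then have "x * b' * c' * y = 0" using xy(1-3) by (rule less.hyps)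
    moreover have "x * y \<noteq> 0" "b' * c' \<noteq> 0" unfolding xy(4,5) using nz by simp_all
    ultimately show False by simp
  qed
  show ?case
  proof (rule ccontr)
    assume nz: "a * b * c * d \<noteq> 0"
    \<comment> \<open>This makes the swapped tuple an admissible solution.\<close>
    have cop: "coprime b c"
    proof (rule coprime_int_primeI)
      fix p :: int assume p: "prime p" "p dvd b" "p dvd c"
      then have "p dvd b\<^sup>2 - c\<^sup>2" "p dvd a\<^sup>2 - d\<^sup>2"
        unfolding less.prems(2) by (simp_all add: power2_eq_square)
      then have *: "p dvd a * d" "p dvd a\<^sup>2 - d\<^sup>2" using less.prems(3) by simp_all
      have "p dvd a \<and> p dvd d"
      proof (cases "p dvd a")
        case True
        then have "p dvd d\<^sup>2" using *(2) by (simp add: dvd_diff_right_iff power2_eq_square)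
        then show ?thesis using True p by (meson prime_dvd_power)
      next
        case False
        then have "p dvd d" using *(1) p by (simp add: prime_dvd_mult_iff)
        then have "p dvd a\<^sup>2" using *(2) by (simp add: dvd_diff_left_iff power2_eq_square)
        then show ?thesis using p \<open>p dvd d\<close> by (meson prime_dvd_power)
      qed
      then show False using less.prems(1) p by (meson coprime_common_divisor not_prime_unit)
    qed
    from nz have nz': "a \<noteq> 0" "b \<noteq> 0" "c \<noteq> 0" "d \<noteq> 0" by auto
    from less.prems nz'(1,4) show False
    proof (cases rule: diff_quadric_split)
      case (1 e f g h)
      have "a * b * c * d = (e * f) * (g * h) * (b * c)" unfolding 1(1,2) by (simp add: mult_ac)
      then show False using descent[OF 1(3-5), of "b * c"] nz by (metis mult_eq_0_iff)
    next
      case (2 e)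
      from cop less.prems(3,2) nz'(2,3) show False
      proof (cases rule: diff_quadric_split)
        case (1 e f g h)
        have "a * b * c * d = (e * f) * (g * h) * (a * d)" unfolding 1(1,2) by (simp add: mult_ac)
        then show False using descent[OF 1(3-5), of "a * d"] nz by (metis mult_eq_0_iff)
      next
        case (2 e')
        \<comment> \<open>Class 5 on both sides would make 5 times a square equal to 25 times a
          square.\<close>
        have "5 * (a*b - 2*a*c - 2*b*d + 2*c*d)\<^sup>2 = (5 * (e\<^sup>2)\<^sup>2) * (5 * (e'\<^sup>2)\<^sup>2)"
          using norm_product_identity[OF less.prems(2,3)] \<open>a\<^sup>2 + 4 * (b - c)\<^sup>2 = _\<close> 2(2) by simp
        then have "(a*b - 2*a*c - 2*b*d + 2*c*d)\<^sup>2 = 5 * (e\<^sup>2 * e'\<^sup>2)\<^sup>2"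
          by (simp add: power_mult_distrib)
        then have "e\<^sup>2 * e'\<^sup>2 = 0" by (rule square_eq_5_square)
        then show False using \<open>e \<noteq> 0\<close> 2(1) by simp
      qed
    qed
  qed
qed

subsection \<open>Descent on the twist by 5\<close>

lemma odd_square_cases:
  fixes z :: int
  assumes "odd z"
  obtains k where "z\<^sup>2 = 8 * k + 1"
proof -
  obtain m where m: "z = 2 * m + 1" using assms by (elim oddE)
  have "even (m * (m + 1))" by simp
  then obtain k where "m * (m + 1) = 2 * k" by blast
  then have "z\<^sup>2 = 8 * k + 1" unfolding m by (simp add: power2_eq_square algebra_simps)
  then show thesis by (rule that)
qed

text \<open>A common prime divides u - v, hence not \<open>y\<close>; its square would have to
  divide 5.\<close>

lemma coprime_diff_of_prod_eq_5_square:
  fixes u v y :: int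
  assumes "u * v = 5 * y\<^sup>2" "coprime (u - v) y"
  shows "coprime u v"
proof (rule coprime_int_primeI)
  fix p :: int assume p: "prime p" "p dvd u" "p dvd v"
  then have "p dvd u - v" by simp
  then have "\<not> p dvd y" using assms(2) p(1) by (meson coprime_common_divisor not_prime_unit)
  then have "coprime (p * p) (y\<^sup>2)" using p(1) by (simp add: prime_imp_coprime)
  moreover have "p * p dvd 5 * y\<^sup>2" using p(2,3) unfolding assms(1)[symmetric] by (rule mult_dvd_mono)
  ultimately have pp: "p * p dvd 5" by (simp add: coprime_dvd_mult_left_iff)
  then have "p dvd 5" by (metis dvd_mult_left)
  then have "p = 5" using p(1) by (intro primes_dvd_imp_eq) simp_all
  then show False using pp by simp
qed

text \<open>As in \<open>pythagorean_split\<close>, with coprime factors of 5 y^2. The factor that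
  absorbs 5 decides the sign in the formula for \<open>n\<close>.\<close>

lemma five_square_split:
  fixes z n y :: int
  assumes "z\<^sup>2 = n\<^sup>2 + 20 * y\<^sup>2" "coprime n y" "z \<ge> 0"
  obtains r s where "z = s\<^sup>2 + 5 * r\<^sup>2" "n = s\<^sup>2 - 5 * r\<^sup>2 \<or> n = 5 * r\<^sup>2 - s\<^sup>2" "y = r * s"
proof -
  have "even z = even n" using assms(1) by (metis even_add even_mult_iff even_numeral even_power pos2)
  then obtain u v where uv: "z + n = 2 * u" "z - n = 2 * v"
    by (metis dvdE even_add even_diff)
  then have zn: "z = u + v" "n = u - v" by auto
  have prod: "u * v = 5 * y\<^sup>2" using assms(1) unfolding zn by (simp add: power2_eq_square algebra_simps)
  have cop: "coprime u v"
    using prod assms(2) coprime_diff_of_prod_eq_5_square unfolding zn by blast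
  have "n\<^sup>2 \<le> z\<^sup>2" using assms(1) by simp
  then have "\<bar>n\<bar> \<le> z" using assms(3) by (simp add: abs_le_square_iff[symmetric])
  then have nonneg: "u \<ge> 0" "v \<ge> 0" using uv by auto
  have "5 dvd u * v" unfolding prod by simp
  then have "5 dvd u \<or> 5 dvd v" by (simp add: prime_dvd_mult_iff)
  then show thesis
  proof
    assume "5 dvd u"
    then obtain u' where u': "u = 5 * u'" by blast
    then obtain r s where "u' = r\<^sup>2" "v = s\<^sup>2" "y = r * s"
      using coprime_mult_eq_square[of u' v y] cop nonneg prod by auto
    then show thesis using that[of s r] zn u' by simp
  next
    assume "5 dvd v"
    then obtain v' where v': "v = 5 * v'" by blast
    then obtain s r where "u = s\<^sup>2" "v' = r\<^sup>2" "y = s * r"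
      using coprime_mult_eq_square[of u v' y] cop nonneg prod by auto
    then show thesis using that[of s r] zn v' by (simp add: mult.commute)
  qed
qed

text \<open>For odd \<open>X\<close> work modulo 8: if \<open>A\<close> is odd, D^2 is congruent to
  6. If A = 2 a, the first equation forces \<open>a\<close> to be odd, and then (B/2)^2 is congruent
  to 5.\<close>

lemma concordant_even:
  fixes A D B X :: int
  assumes "A\<^sup>2 + 5 * X\<^sup>2 = D\<^sup>2" "A\<^sup>2 + 80 * X\<^sup>2 = B\<^sup>2"
  shows "even X"
proof (rule ccontr)
  assume "odd X"
  then obtain x where x: "X\<^sup>2 = 8 * x + 1" by (rule odd_square_cases)
  show False
  proof (cases "even A")
    case False
    then obtain a where a: "A\<^sup>2 = 8 * a + 1" by (rule odd_square_cases)
    then have D: "D\<^sup>2 = 8 * a + 40 * x + 6" using assms(1) x by simp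
    then have "even (D\<^sup>2)" by simp
    then obtain d where "D = 2 * d" by auto
    then have "2 * d\<^sup>2 = 2 * (2 * a + 10 * x + 1) + 1" using D by (simp add: power_mult_distrib)
    then have "odd (2 * d\<^sup>2)" by (metis even_plus_one_iff dvd_triv_left)
    then show False by simp
  next
    case True
    then obtain a where a: "A = 2 * a" by blast
    have D: "D\<^sup>2 = 4 * a\<^sup>2 + 40 * x + 5" using assms(1) unfolding a x by (simp add: power_mult_distrib)
    then have "odd (D\<^sup>2)" by simp
    then have "odd D" by simp
    then obtain d where "D\<^sup>2 = 8 * d + 1" by (rule odd_square_cases)
    then have "8 * d + 1 = 4 * a\<^sup>2 + 40 * x + 5" using D by simp
    then have "a\<^sup>2 = 2 * (d - 5 * x - 1) + 1" by simp
    then have "odd (a\<^sup>2)" by simp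
    then have "odd a" by simp
    then obtain a' where a': "a\<^sup>2 = 8 * a' + 1" by (rule odd_square_cases)
    have B: "B\<^sup>2 = 4 * (8 * (a' + 20 * x) + 21)"
      using assms(2) unfolding a by (simp add: power_mult_distrib a' x)
    then have "even (B\<^sup>2)" by simp
    then obtain b where b: "B = 2 * b" by auto
    then have b2: "b\<^sup>2 = 8 * (a' + 20 * x) + 21" using B by (simp add: power_mult_distrib)
    then have "odd (b\<^sup>2)" by simp
    then have "odd b" by simp
    then obtain b' where "b\<^sup>2 = 8 * b' + 1" by (rule odd_square_cases)
    then have "2 * b' = 2 * (a' + 20 * x + 2) + 1" using b2 by simp
    then have "odd (2 * b')" by (metis even_plus_one_iff dvd_triv_left)
    then show False by simp
  qed
qed

text \<open>Excludes opposite signs in the two representations of \<open>A\<close> in the descent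
  below. Modulo 3 the equation says that the four squares sum to 0. By coprimality all four are
  units if 3 does not divide \<open>x\<close>, and exactly two are otherwise, so the sum is 4 or
  2.\<close>

lemma sum_squares_3:
  fixes p q r s x :: int
  assumes "s\<^sup>2 - 5 * r\<^sup>2 = 5 * q\<^sup>2 - p\<^sup>2" "x = r * s" "4 * x = q * p" "coprime (s\<^sup>2 - 5 * r\<^sup>2) x"
  shows False
proof -
  have 1: "3 dvd x \<longleftrightarrow> 3 dvd r \<or> 3 dvd s" unfolding assms(2) by (simp add: prime_dvd_mult_iff)
  have "3 dvd 4 * x \<longleftrightarrow> 3 dvd q \<or> 3 dvd p" unfolding assms(3) by (simp add: prime_dvd_mult_iff)
  then have 2: "3 dvd x \<longleftrightarrow> 3 dvd q \<or> 3 dvd p" by (simp add: prime_dvd_mult_iff)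
  have 3: "\<not> (3 dvd s\<^sup>2 - 5 * r\<^sup>2 \<and> 3 dvd x)"
    using coprime_common_divisor[OF assms(4), of 3] by auto
  have sq: "\<exists>k. z\<^sup>2 = 3 * k + (if 3 dvd z then 0 else 1)" for z :: int
    using mult_div_mod_eq[of 3 "z\<^sup>2"] unfolding square_mod_3 by metis
  obtain s' r' q' p' where sq: "s\<^sup>2 = 3 * s' + (if 3 dvd s then 0 else 1)" "r\<^sup>2 = 3 * r' + (if 3 dvd r then 0 else 1)"
    "q\<^sup>2 = 3 * q' + (if 3 dvd q then 0 else 1)" "p\<^sup>2 = 3 * p' + (if 3 dvd p then 0 else 1)"
    using sq[of s] sq[of r] sq[of q] sq[of p] by blast
  note eq = assms(1)[unfolded sq]
  \<comment> \<open>The listed values are what the residues of the four squares can contribute to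
    the equation; none is a multiple of 3.\<close>
  have no3: "3 * a \<noteq> m" if "m \<in> {-2, 4, 8, 10}" for a m :: int
    using that by (elim insertE emptyE) presburger+
  have res: "3 * (s' - 5 * r' - 5 * q' + p') \<noteq> m" if "m \<in> {-2, 4, 8, 10}" for m
    using no3 that .
  show False
  proof (cases "3 dvd x")
    case False
    then have "3 * (s' - 5 * r' - 5 * q' + p') \<in> {8}" using eq 1 2 by simp
    then show False using res by blast
  next
    case True
    have "\<not> (3 dvd r \<and> 3 dvd s)" using 3 True by (auto simp: power2_eq_square)
    then have rs: "(3 dvd r \<and> \<not> 3 dvd s) \<or> (\<not> 3 dvd r \<and> 3 dvd s)" using 1 True by blast
    have "\<not> (3 dvd q \<and> 3 dvd p)" using 3 True unfolding assms(1) by (auto simp: power2_eq_square)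
    then have qp: "(3 dvd q \<and> \<not> 3 dvd p) \<or> (\<not> 3 dvd q \<and> 3 dvd p)" using 2 True by blast
    have "3 * (s' - 5 * r' - 5 * q' + p') \<in> {-2, 4, 10}"
      using rs qp
    proof (elim disjE conjE, goal_cases)
      case 1 then show ?case using eq by simp
    next
      case 2 then show ?case using eq by simp
    next
      case 3 then show ?case using eq by simp
    next
      case 4 then show ?case using eq by simp
    qed
    then show False using res by blast
  qed
qed

text \<open>3 is not a square modulo 5, so p^2 = 3 w^2 modulo 5 forces 5 to divide p^2.\<close>

lemma five_dvd_of_eq_3_square:
  fixes p r w :: int
  assumes "p\<^sup>2 + 5 * r = 3 * w\<^sup>2"
  shows "5 dvd p\<^sup>2 + 5 * r"
proof -
  have sq: "\<exists>k. z\<^sup>2 = 5 * k \<or> z\<^sup>2 = 5 * k + 1 \<or> z\<^sup>2 = 5 * k + 4" for z :: int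
  proof -
    have sq: "z\<^sup>2 mod 5 = (z mod 5)\<^sup>2 mod 5" by (rule power_mod[symmetric])
    have "z mod 5 = 0 \<or> z mod 5 = 1 \<or> z mod 5 = 2 \<or> z mod 5 = 3 \<or> z mod 5 = 4" by presburger
    then have "z\<^sup>2 mod 5 = 0 \<or> z\<^sup>2 mod 5 = 1 \<or> z\<^sup>2 mod 5 = 4"
      unfolding sq by (elim disjE) (simp_all only:, simp_all)
    then show ?thesis using mult_div_mod_eq[of 5 "z\<^sup>2"] by (metis add.right_neutral)
  qed
  obtain k where k: "p\<^sup>2 = 5 * k \<or> p\<^sup>2 = 5 * k + 1 \<or> p\<^sup>2 = 5 * k + 4" using sq by blast
  obtain l where l: "w\<^sup>2 = 5 * l \<or> w\<^sup>2 = 5 * l + 1 \<or> w\<^sup>2 = 5 * l + 4" using sq by blast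
  have no5: "5 * a \<noteq> m" if "m \<in> {-4, -1, 2, 8, 11}" for a m :: int
    using that by (elim insertE emptyE) presburger+
  have "p\<^sup>2 = 5 * k"
  proof (rule ccontr)
    assume "p\<^sup>2 \<noteq> 5 * k"
    then have "p\<^sup>2 = 5 * k + 1 \<or> p\<^sup>2 = 5 * k + 4" using k by blast
    then have "5 * (k + r - 3 * l) \<in> {-4, -1, 2, 8, 11}"
      using l
    proof (elim disjE, goal_cases)
      case 1 then show ?case using assms by simp
    next
      case 2 then show ?case using assms by simp
    next
      case 3 then show ?case using assms by simp
    next
      case 4 then show ?case using assms by simp
    next
      case 5 then show ?case using assms by simp
    next
      case 6 then show ?case using assms by simp
    qed
    then show False using no5 by blast
  qed
  then show ?thesis by simp
qed

text \<open>
  The point with abscissa \<open>(A/X)\<^sup>2\<close> is twice a point of \<open>y\<^sup>2 = x(x + 5)(x + 80)\<close>; for a suitable choice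
  of signs the half has the abscissa \<open>(p/r)\<^sup>2\<close> and is again divisible by 2. The other square
  classes are excluded modulo 3 and modulo 5.
\<close>

lemma no_concordant:
  fixes A D B X :: int
  assumes "A\<^sup>2 + 5 * X\<^sup>2 = D\<^sup>2" "A\<^sup>2 + 80 * X\<^sup>2 = B\<^sup>2"
  shows "X = 0"
  using assms
proof (induction "nat \<bar>X\<bar>" arbitrary: A D B X rule: less_induct)
  case less
  show ?case
  proof (rule ccontr)
    assume "X \<noteq> 0"
    \<comment> \<open>Dividing out a common factor would give a smaller solution.\<close>
    have cop: "coprime A X"
    proof (rule ccontr)
      assume nc: "\<not> coprime A X"
      define g where "g = gcd A X"
      have "g \<noteq> 0" "g > 0" using \<open>X \<noteq> 0\<close> unfolding g_def by simp_all
      obtain a x where ax: "A = a * g" "X = x * g" unfolding g_def by (metis dvdE gcd_dvd1 gcd_dvd2 mult.commute)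
      have "g\<^sup>2 * (a\<^sup>2 + 5 * x\<^sup>2) = D\<^sup>2" "g\<^sup>2 * (a\<^sup>2 + 80 * x\<^sup>2) = B\<^sup>2"
        unfolding less.prems[symmetric] ax by (simp_all add: power2_eq_square algebra_simps)
      then have *: "g\<^sup>2 dvd D\<^sup>2" "g\<^sup>2 dvd B\<^sup>2" "(a\<^sup>2 + 5 * x\<^sup>2) * g\<^sup>2 = D\<^sup>2" "(a\<^sup>2 + 80 * x\<^sup>2) * g\<^sup>2 = B\<^sup>2"
        by (metis dvd_triv_left, metis dvd_triv_left, simp_all add: mult.commute)
      then obtain d b where db: "D = d * g" "B = b * g" by (metis dvdE mult.commute pow_divides_pow_iff pos2)
      have "a\<^sup>2 + 5 * x\<^sup>2 = d\<^sup>2" "a\<^sup>2 + 80 * x\<^sup>2 = b\<^sup>2"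
        using *(3,4) \<open>g \<noteq> 0\<close> unfolding db power_mult_distrib by simp_all
      moreover have "nat \<bar>x\<bar> < nat \<bar>X\<bar>"
      proof -
        have "g \<noteq> 1" using nc unfolding g_def coprime_iff_gcd_eq_1 .
        then have "g > 1" using \<open>g > 0\<close> by simp
        then have "\<bar>x\<bar> * 1 < \<bar>x\<bar> * g" using \<open>X \<noteq> 0\<close> ax by (intro mult_strict_left_mono) auto
        then show ?thesis using \<open>g > 0\<close> unfolding ax by (simp add: abs_mult)
      qed
      ultimately have "x = 0" using less.hyps by blast
      then show False using ax \<open>X \<noteq> 0\<close> by simp
    qed
    obtain x where x: "X = 2 * x" using concordant_even[OF less.prems] by blast
    have "x \<noteq> 0" using \<open>X \<noteq> 0\<close> x by simp
    have "odd A" using cop x by auto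
    have copx: "coprime A x" using cop x by simp
    have "coprime A (2\<^sup>2)" using \<open>odd A\<close> by (simp only: coprime_power_right_iff coprime_right_2_iff_odd simp_thms)
    then have copx4: "coprime A (4 * x)" using copx by simp
    \<comment> \<open>With X = 2 x both equations have the shape of
      \<open>five_square_split\<close>, with \<open>x\<close> and 4 x as the last variable.\<close>
    have 1: "\<bar>D\<bar>\<^sup>2 = A\<^sup>2 + 20 * x\<^sup>2" using less.prems(1) x by (simp add: power_mult_distrib)
    have 2: "\<bar>B\<bar>\<^sup>2 = A\<^sup>2 + 20 * (4 * x)\<^sup>2" using less.prems(2) x by (simp add: power_mult_distrib)
    obtain r s where rs: "\<bar>D\<bar> = s\<^sup>2 + 5 * r\<^sup>2" "A = s\<^sup>2 - 5 * r\<^sup>2 \<or> A = 5 * r\<^sup>2 - s\<^sup>2" "x = r * s"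
      by (rule five_square_split[OF 1 copx abs_ge_zero])
    obtain q p where qp: "\<bar>B\<bar> = p\<^sup>2 + 5 * q\<^sup>2" "A = p\<^sup>2 - 5 * q\<^sup>2 \<or> A = 5 * q\<^sup>2 - p\<^sup>2" "4 * x = q * p"
      by (rule five_square_split[OF 2 copx4 abs_ge_zero])
    have cop': "coprime (s\<^sup>2 - 5 * r\<^sup>2) x"
      using rs(2) copx by (metis coprime_minus_left_iff minus_diff_eq)
    have "s\<^sup>2 - 5 * r\<^sup>2 \<noteq> 5 * q\<^sup>2 - p\<^sup>2"
      using sum_squares_3[OF _ rs(3) qp(3) cop'] by blast
    then have eq: "s\<^sup>2 - 5 * r\<^sup>2 = p\<^sup>2 - 5 * q\<^sup>2"
      using rs(2) qp(2) by auto
    have s5: "\<not> 5 dvd s"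
    proof
      assume "5 dvd s"
      then obtain s' where s': "s = 5 * s'" by blast
      then have "5 dvd s\<^sup>2 - 5 * r\<^sup>2" "5 dvd x" unfolding rs(3) by (simp_all add: power2_eq_square)
      then show False using coprime_common_divisor[OF cop', of 5] by simp
    qed
    have sum_eq: "p\<^sup>2 + 5 * r\<^sup>2 = s\<^sup>2 + 5 * q\<^sup>2" using eq by simp
    \<comment> \<open>The two representations of \<open>A\<close> and the two factorizations of
      \<open>x\<close> combine to a product of coprime factors equal to 15 x^2. It remains to place
      the primes 5 and 3.\<close>
    have prod: "(p\<^sup>2 + 5 * r\<^sup>2) * (q\<^sup>2 - r\<^sup>2) = 15 * x\<^sup>2"
    proof -
      have "16 * x\<^sup>2 = q\<^sup>2 * p\<^sup>2" using arg_cong[OF qp(3), of "\<lambda>z. z\<^sup>2"] by (simp add: power_mult_distrib)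
      moreover have "x\<^sup>2 = r\<^sup>2 * s\<^sup>2" using rs(3) by (simp add: power_mult_distrib)
      ultimately show ?thesis using eq by algebra
    qed
    have P5: "\<not> 5 dvd p\<^sup>2 + 5 * r\<^sup>2"
      unfolding sum_eq using s5 by (simp add: dvd_add_left_iff prime_dvd_power_iff)
    have copPR: "coprime (p\<^sup>2 + 5 * r\<^sup>2) (q\<^sup>2 - r\<^sup>2)"
    proof (rule coprime_int_primeI)
      fix l :: int assume l: "prime l" "l dvd p\<^sup>2 + 5 * r\<^sup>2" "l dvd q\<^sup>2 - r\<^sup>2"
      have "\<not> l dvd x"
      proof
        assume "l dvd x"
        have *: "l dvd r \<longleftrightarrow> l dvd q"
          using l(1,3) by (metis dvd_diff_left_iff dvd_diff_right_iff prime_dvd_power_iff pos2)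
        have "l dvd r \<and> l dvd s"
        proof (cases "l dvd r")
          case True
          then have "l dvd q" using * by simp
          then have "l dvd s\<^sup>2" using l(2) unfolding sum_eq by (simp add: dvd_add_left_iff power2_eq_square)
          then show ?thesis using True l(1) by (meson prime_dvd_power)
        next
          case False
          then have "l dvd s" using \<open>l dvd x\<close> l(1) unfolding rs(3) by (simp add: prime_dvd_mult_iff)
          then have "l dvd 5 * q\<^sup>2" using l(2) unfolding sum_eq by (simp add: dvd_add_right_iff power2_eq_square)
          moreover have "\<not> l dvd q" using False * by simp
          ultimately have "l dvd 5" using l(1) by (simp add: prime_dvd_mult_iff prime_dvd_power_iff)
          then have "l = 5" using l(1) by (intro primes_dvd_imp_eq) simp_all
          then show ?thesis using l(2) P5 by simp
        qed
        then have "l dvd s\<^sup>2 - 5 * r\<^sup>2" by (simp add: power2_eq_square)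
        then show False using coprime_common_divisor[OF cop' _ \<open>l dvd x\<close>] l(1) not_prime_unit by blast
      qed
      then have "coprime (l * l) (x\<^sup>2)" using l(1) by (simp add: prime_imp_coprime)
      moreover have "l * l dvd 15 * x\<^sup>2" unfolding prod[symmetric] using l(2,3) by (rule mult_dvd_mono)
      ultimately have "l * l dvd 15" by (simp add: coprime_dvd_mult_left_iff)
      moreover have "l > 1" using l(1) by (rule prime_gt_1_int)
      ultimately have "l * l \<in> {1, 3, 5, 15}" by (intro dvd_15) simp_all
      moreover have "l = 2 \<or> l = 3 \<or> l * l \<ge> 4 * 4"
        using \<open>l > 1\<close> mult_mono[of 4 l 4 l] by linarith
      ultimately show False by auto
    qed
    have "p \<noteq> 0" "s \<noteq> 0" "r \<noteq> 0" using rs(3) qp(3) \<open>x \<noteq> 0\<close> by auto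
    then have "p\<^sup>2 + 5 * r\<^sup>2 > 0" by (simp add: add_pos_pos)
    moreover have "15 * x\<^sup>2 > 0" using \<open>x \<noteq> 0\<close> by simp
    ultimately have R: "q\<^sup>2 - r\<^sup>2 \<ge> 0" unfolding prod[symmetric] by (simp add: zero_less_mult_iff)
    have "5 dvd (p\<^sup>2 + 5 * r\<^sup>2) * (q\<^sup>2 - r\<^sup>2)" unfolding prod by simp
    then have "5 dvd q\<^sup>2 - r\<^sup>2" using P5 by (simp add: prime_dvd_mult_iff)
    then obtain t where t: "q\<^sup>2 - r\<^sup>2 = 5 * t" by blast
    have prod3: "(p\<^sup>2 + 5 * r\<^sup>2) * t = 3 * x\<^sup>2" using prod unfolding t by algebra
    have copt: "coprime (p\<^sup>2 + 5 * r\<^sup>2) t" using copPR unfolding t by simp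
    have "t \<ge> 0" using R t by simp
    have "3 dvd (p\<^sup>2 + 5 * r\<^sup>2) * t" unfolding prod3 by simp
    then have "3 dvd p\<^sup>2 + 5 * r\<^sup>2 \<or> 3 dvd t" by (simp add: prime_dvd_mult_iff)
    \<comment> \<open>5 has gone to the other factor. If 3 went to this one, it would be 3 times a
      square, which fails modulo 5.\<close>
    then obtain w where w: "p\<^sup>2 + 5 * r\<^sup>2 = w\<^sup>2"
    proof
      assume "3 dvd p\<^sup>2 + 5 * r\<^sup>2"
      then obtain u where u: "p\<^sup>2 + 5 * r\<^sup>2 = 3 * u" by blast
      have "coprime u t" "u * t = x\<^sup>2" using copt prod3 unfolding u by simp_all
      moreover have "u \<ge> 0" using \<open>p\<^sup>2 + 5 * r\<^sup>2 > 0\<close> u by simp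
      ultimately obtain w where "u = w\<^sup>2" using \<open>t \<ge> 0\<close> by (metis coprime_mult_eq_square)
      then have "5 dvd p\<^sup>2 + 5 * r\<^sup>2" using u five_dvd_of_eq_3_square by blast
      then show thesis using P5 by simp
    next
      assume "3 dvd t"
      then obtain t' where t': "t = 3 * t'" by blast
      have "coprime (p\<^sup>2 + 5 * r\<^sup>2) t'" "(p\<^sup>2 + 5 * r\<^sup>2) * t' = x\<^sup>2" using copt prod3 unfolding t' by simp_all
      moreover have "t' \<ge> 0" using \<open>t \<ge> 0\<close> t' by simp
      ultimately show thesis using \<open>p\<^sup>2 + 5 * r\<^sup>2 > 0\<close> that by (metis coprime_mult_eq_square less_imp_le)
    qed
    \<comment> \<open>Hence p^2 + 80 r^2 is the square of p w / s. With p^2 + 5 r^2 = w^2 this is a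
      solution of the original system, smaller because X = 2 r s.\<close>
    have "s\<^sup>2 * (p\<^sup>2 + 80 * r\<^sup>2) = p\<^sup>2 * (s\<^sup>2 + 5 * q\<^sup>2)"
    proof -
      have "16 * x\<^sup>2 = q\<^sup>2 * p\<^sup>2" using arg_cong[OF qp(3), of "\<lambda>z. z\<^sup>2"] by (simp add: power_mult_distrib)
      moreover have "x\<^sup>2 = r\<^sup>2 * s\<^sup>2" using rs(3) by (simp add: power_mult_distrib)
      ultimately show ?thesis by algebra
    qed
    also have "\<dots> = (p * w)\<^sup>2" unfolding sum_eq[symmetric] w by (simp add: power_mult_distrib)
    finally have pw: "s\<^sup>2 * (p\<^sup>2 + 80 * r\<^sup>2) = (p * w)\<^sup>2" .
    then have "s\<^sup>2 dvd (p * w)\<^sup>2" by (metis dvd_triv_left)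
    then obtain b where b: "p * w = s * b" by (metis dvdE pow_divides_pow_iff pos2)
    then have "p\<^sup>2 + 80 * r\<^sup>2 = b\<^sup>2" using pw \<open>s \<noteq> 0\<close> by (simp add: power_mult_distrib)
    moreover have "nat \<bar>r\<bar> < nat \<bar>X\<bar>"
    proof -
      have "\<bar>r\<bar> * 1 \<le> \<bar>r\<bar> * \<bar>s\<bar>" using \<open>s \<noteq> 0\<close> by (intro mult_left_mono) auto
      moreover have "\<bar>r\<bar> * \<bar>s\<bar> < \<bar>X\<bar>" using \<open>x \<noteq> 0\<close> unfolding x rs(3) by (simp add: abs_mult)
      ultimately show ?thesis by linarith
    qed
    ultimately have "r = 0" using less.hyps w by blast
    then show False using \<open>r \<noteq> 0\<close> by simp
  qed
qed

subsection \<open>Rational points on the two quartics\<close>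

text \<open>By coprimality f g and e^2 + s h^2 divide each other, so they agree up to sign. Changing
  the signs of \<open>e\<close> and \<open>g\<close> absorbs the minus sign.\<close>

lemma quadric_signs:
  fixes e f g h s :: int
  assumes "coprime e h" "coprime f g" "e * f * g * h \<noteq> 0" "\<bar>s\<bar> = 1"
    and eq: "(e\<^sup>2 + s * h\<^sup>2) * (f\<^sup>2 - g\<^sup>2) = e * f * g * h"
  obtains a b c d where "coprime a d" "a\<^sup>2 + s * d\<^sup>2 = b * c" "b\<^sup>2 - c\<^sup>2 = a * d" "a * b * c * d \<noteq> 0"
proof -
  have nz: "f * g \<noteq> 0" using assms(3) by simp
  define P where "P = e\<^sup>2 + s * h\<^sup>2"
  have eq': "P * (f\<^sup>2 - g\<^sup>2) = (e * h) * (f * g)" using eq unfolding P_def by (simp add: ac_simps)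
  have "coprime (e * h) P" using coprime_prod_form[of e h s 0] assms(1,4) unfolding P_def by simp
  then have "P dvd f * g"
    using coprime_dvd_mult_right_iff[of P "e * h" "f * g"] eq'[symmetric] by (simp add: coprime_commute)
  moreover have "coprime (f * g) (f\<^sup>2 - g\<^sup>2)" using coprime_prod_form[of f g "-1" 0] assms(2) by simp
  then have "f * g dvd P"
    using coprime_dvd_mult_left_iff[of "f * g" "f\<^sup>2 - g\<^sup>2" P] unfolding eq' by simp
  ultimately have "\<bar>f * g\<bar> = \<bar>P\<bar>" by (intro zdvd_antisym_abs)
  then have "f * g = P \<or> f * g = - P" by (simp only: abs_eq_iff)
  then show thesis
  proof
    assume 1: "f * g = P"
    have "(f * g) * (f\<^sup>2 - g\<^sup>2) = (f * g) * (e * h)" using eq' unfolding 1 by (simp only: mult.commute)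
    then have "f\<^sup>2 - g\<^sup>2 = e * h" using nz by (metis mult_left_cancel)
    moreover have "e\<^sup>2 + s * h\<^sup>2 = f * g" unfolding 1 P_def ..
    ultimately show thesis using that[of e h f g] assms(1,3) by blast
  next
    assume 2: "f * g = - P"
    have "(f * g) * (f\<^sup>2 - g\<^sup>2) = - ((e * h) * (f * g))" unfolding eq'[symmetric] unfolding 2 by (rule mult_minus_left)
    also have "\<dots> = (f * g) * (- e * h)" by (simp only: mult_minus_left mult_minus_right mult.commute)
    finally have "f\<^sup>2 - g\<^sup>2 = - e * h" using nz by (metis mult_left_cancel)
    then have "f\<^sup>2 - (- g)\<^sup>2 = - e * h" by (simp only: power2_minus)
    moreover have "(- e)\<^sup>2 + s * h\<^sup>2 = f * - g" using 2 unfolding P_def by (simp only: power2_minus mult_minus_right minus_minus)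
    moreover have "coprime (- e) h" "- e * f * - g * h \<noteq> 0" using assms(1,3) by simp_all
    ultimately show thesis using that[of "- e" h f "- g"] by blast
  qed
qed

lemma odd_form:
  fixes u v :: int
  assumes "coprime u v"
  shows "odd (u\<^sup>2 + u * v + v\<^sup>2)"
proof
  assume "even (u\<^sup>2 + u * v + v\<^sup>2)"
  then have "even u \<and> even v" by (auto simp: even_add)
  then show False using assms coprime_common_divisor[of u v 2] by simp
qed

text \<open>The factors differ by 4 u v, the second is odd, and it is coprime to u v.\<close>

lemma coprime_quartic_factors:
  fixes u v :: int
  assumes "coprime u v"
  shows "coprime (u\<^sup>2 - 3 * (u * v) + v\<^sup>2) (u\<^sup>2 + u * v + v\<^sup>2)"
proof (rule coprime_int_primeI)
  fix p :: int assume p: "prime p" "p dvd u\<^sup>2 - 3 * (u * v) + v\<^sup>2" "p dvd u\<^sup>2 + u * v + v\<^sup>2"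
  then have "p dvd (u\<^sup>2 + u * v + v\<^sup>2) - (u\<^sup>2 - 3 * (u * v) + v\<^sup>2)" by (intro dvd_diff)
  then have "p dvd 2 * 2 * (u * v)" by simp
  then have "p dvd 2 \<or> p dvd u * v" using p(1) by (metis prime_dvd_mult_iff)
  then show False
  proof
    assume "p dvd 2"
    then have "p = 2" using p(1) by (intro primes_dvd_imp_eq) simp_all
    then show False using p(3) odd_form[OF assms] by simp
  next
    assume "p dvd u * v"
    then show False using prime_dvd_form[of p u v 1 1] p assms by simp
  qed
qed

lemma form_pos:
  fixes u v :: int
  assumes "u * v \<noteq> 0"
  shows "u\<^sup>2 + u * v + v\<^sup>2 > 0"
proof -
  have "4 * (u\<^sup>2 + u * v + v\<^sup>2) = (2 * u + v)\<^sup>2 + 3 * v\<^sup>2" by (simp add: power2_eq_square algebra_simps)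
  moreover have "v\<^sup>2 > 0" using assms by simp
  ultimately show ?thesis by (smt (verit) zero_le_power2)
qed

text \<open>Both coprime factors must be squares A^2 and B^2, with B^2 - A^2 = 4 u v. The
  four-number parametrization of u v = m n turns the equation for B^2 into the input of
  \<open>quadric_signs\<close> with s = -1, contradicting \<open>no_diff_quadric\<close>.\<close>

lemma quartic1_not_square:
  fixes u v y :: int
  assumes "coprime u v" "u * v \<noteq> 0"
  shows "(u\<^sup>2 - 3 * (u * v) + v\<^sup>2) * (u\<^sup>2 + u * v + v\<^sup>2) \<noteq> y\<^sup>2"
proof
  assume eq: "(u\<^sup>2 - 3 * (u * v) + v\<^sup>2) * (u\<^sup>2 + u * v + v\<^sup>2) = y\<^sup>2"
  have pos: "u\<^sup>2 + u * v + v\<^sup>2 > 0" using assms(2) by (rule form_pos)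
  moreover have "(u\<^sup>2 - 3 * (u * v) + v\<^sup>2) * (u\<^sup>2 + u * v + v\<^sup>2) \<ge> 0" unfolding eq by simp
  ultimately have "u\<^sup>2 - 3 * (u * v) + v\<^sup>2 \<ge> 0" by (simp add: zero_le_mult_iff)
  then obtain A B where A: "u\<^sup>2 - 3 * (u * v) + v\<^sup>2 = A\<^sup>2" and B: "u\<^sup>2 + u * v + v\<^sup>2 = B\<^sup>2"
    using coprime_mult_eq_square[OF coprime_quartic_factors[OF assms(1)] _ less_imp_le[OF pos] eq] by metis
  have AB: "B\<^sup>2 = A\<^sup>2 + 4 * (u * v)" unfolding A[symmetric] B[symmetric] by simp
  then have "even B = even A" by (metis even_add even_mult_iff even_numeral even_power pos2)
  then obtain m n where mn: "B - A = 2 * m" "B + A = 2 * n" by (metis dvdE even_add even_diff)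
  then have mn': "B = m + n" "A = n - m" by auto
  have "u * v = m * n" using AB unfolding mn' by (simp add: power2_eq_square algebra_simps)
  then obtain e f g h where efgh: "u = e * f" "v = g * h" "m = e * g" "n = f * h" "coprime f g"
    using four_number assms(2) by (metis mult_eq_0_iff)
  have eq: "(e\<^sup>2 + (-1) * h\<^sup>2) * (f\<^sup>2 - g\<^sup>2) = e * f * g * h"
    using B unfolding mn' efgh by (simp add: power2_eq_square algebra_simps)
  have "coprime e h" "e * f * g * h \<noteq> 0" using assms efgh by simp_all
  then show False
  proof (rule quadric_signs[OF _ efgh(5) _ _ eq])
    fix a b c d :: int
    assume "coprime a d" "a\<^sup>2 + (-1) * d\<^sup>2 = b * c" "b\<^sup>2 - c\<^sup>2 = a * d" "a * b * c * d \<noteq> 0"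
    then show False using no_diff_quadric[of a d b c] by simp
  qed simp
qed

text \<open>A square value gives a Pythagorean triple with leg 2 u v. Its parameters satisfy u v = x
  y, and the four-number lemma leads to \<open>quadric_signs\<close> with s = 1, contradicting
  \<open>no_sum_quadric\<close>.\<close>

lemma quartic2_not_square:
  fixes u v z :: int
  assumes "coprime u v" "u * v \<noteq> 0"
  shows "(u\<^sup>2 - u * v - v\<^sup>2)\<^sup>2 + 4 * (u * v)\<^sup>2 \<noteq> z\<^sup>2"
proof
  assume eq: "(u\<^sup>2 - u * v - v\<^sup>2)\<^sup>2 + 4 * (u * v)\<^sup>2 = z\<^sup>2"
  have "coprime (u\<^sup>2 - u * v - v\<^sup>2) (u * v)"
    using coprime_prod_form[of u v "-1" "-1"] assms(1) by (simp add: coprime_commute)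
  moreover have "\<bar>z\<bar>\<^sup>2 = (u\<^sup>2 - u * v - v\<^sup>2)\<^sup>2 + 4 * (u * v)\<^sup>2" using eq by simp
  ultimately obtain x y where xy: "u\<^sup>2 - u * v - v\<^sup>2 = x\<^sup>2 - y\<^sup>2" "u * v = x * y"
    using pythagorean_split abs_ge_zero by metis
  then obtain e f g h where efgh: "u = e * f" "v = g * h" "x = e * g" "y = f * h" "coprime f g"
    using four_number assms(2) by (metis mult_eq_0_iff)
  have eq: "(e\<^sup>2 + 1 * h\<^sup>2) * (f\<^sup>2 - g\<^sup>2) = e * f * g * h"
    using xy(1) unfolding efgh by (simp add: power2_eq_square algebra_simps)
  have "coprime e h" "e * f * g * h \<noteq> 0" using assms efgh by simp_all
  then show False
  proof (rule quadric_signs[OF _ efgh(5) _ _ eq])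
    fix a b c d :: int
    assume "coprime a d" "a\<^sup>2 + 1 * d\<^sup>2 = b * c" "b\<^sup>2 - c\<^sup>2 = a * d" "a * b * c * d \<noteq> 0"
    then show False using no_sum_quadric[of a d b c] by simp
  qed simp
qed

text \<open>For u + v = 5 k one factor is divisible by 5, and the coprime cofactors are squares A^2
  and B^2. With (u - v)^2 = 25 k^2 - 4 u v this is the system of
  \<open>no_concordant\<close>.\<close>

lemma quartic1_5_square:
  fixes k u v y :: int
  assumes "coprime u v" "u * v \<noteq> 0" "(u\<^sup>2 - 3 * (u * v) + v\<^sup>2) * (u\<^sup>2 + u * v + v\<^sup>2) = 5 * y\<^sup>2" "u + v = 5 * k"
  shows "u + v = 0"
proof -
  have 1: "u\<^sup>2 - 3 * (u * v) + v\<^sup>2 = 5 * (5 * k\<^sup>2 - u * v)"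
    using arg_cong[OF assms(4), of "\<lambda>x. x\<^sup>2"] by (simp add: power2_eq_square algebra_simps)
  have 2: "u\<^sup>2 + u * v + v\<^sup>2 = 25 * k\<^sup>2 - u * v"
    using arg_cong[OF assms(4), of "\<lambda>x. x\<^sup>2"] by (simp add: power2_eq_square algebra_simps)
  have prod: "(5 * k\<^sup>2 - u * v) * (25 * k\<^sup>2 - u * v) = y\<^sup>2"
    using assms(3) unfolding 1 2 by (simp only: mult.assoc mult_cancel_left) simp
  have cop: "coprime (5 * k\<^sup>2 - u * v) (25 * k\<^sup>2 - u * v)"
    using coprime_quartic_factors[OF assms(1)] unfolding 1 2 coprime_mult_left_iff by blast
  have pos: "25 * k\<^sup>2 - u * v > 0" unfolding 2[symmetric] using assms(2) by (rule form_pos)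
  moreover have "(5 * k\<^sup>2 - u * v) * (25 * k\<^sup>2 - u * v) \<ge> 0" unfolding prod by simp
  ultimately have "5 * k\<^sup>2 - u * v \<ge> 0" by (simp add: zero_le_mult_iff)
  then obtain A B where AB: "5 * k\<^sup>2 - u * v = A\<^sup>2" "25 * k\<^sup>2 - u * v = B\<^sup>2"
    using coprime_mult_eq_square[OF cop _ less_imp_le[OF pos] prod] by metis
  have "(2 * A)\<^sup>2 + 5 * k\<^sup>2 = (u - v)\<^sup>2"
    using 1 AB(1) by (simp add: power2_eq_square algebra_simps)
  moreover have "(2 * A)\<^sup>2 + 80 * k\<^sup>2 = (2 * B)\<^sup>2"
    using AB by (simp add: power_mult_distrib)
  ultimately have "k = 0" by (rule no_concordant)
  then show ?thesis using assms(4) by simp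
qed

section \<open>The product of the quartics, and passage to rational arguments\<close>

lemma quartic_product_square:
  fixes u v w :: int
  defines "F \<equiv> (u\<^sup>2 - 3 * (u * v) + v\<^sup>2) * (u\<^sup>2 + u * v + v\<^sup>2)"
    and "G \<equiv> (u\<^sup>2 - u * v - v\<^sup>2)\<^sup>2 + 4 * (u * v)\<^sup>2"
  assumes cop: "coprime u v" and nz: "u * v \<noteq> 0" and FG: "F * G = w\<^sup>2"
  shows "u + v = 0"
proof -
  have uv: "\<not> p dvd u * v" if p: "prime p" "p dvd G" for p :: int
  proof
    assume *: "p dvd u * v"
    then have "p dvd 4 * (u * v)\<^sup>2" by (simp add: power2_eq_square)
    then have "p dvd (u\<^sup>2 - u * v - v\<^sup>2)\<^sup>2" using p(2) unfolding G_def by (simp add: dvd_add_left_iff)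
    then have "p dvd u\<^sup>2 - u * v - v\<^sup>2" using p(1) by (rule prime_dvd_power[rotated])
    then show False using prime_dvd_form[of p u v "-1" "-1"] p(1) cop * by simp
  qed
  have common: "p = 5 \<and> p dvd u + v" if p: "prime p" "p dvd F" "p dvd G" for p
  proof -
    have uv: "\<not> p dvd u * v" using uv p by blast
    then have nd: "\<not> p dvd u" "\<not> p dvd v" by auto
    \<comment> \<open>A common prime is odd and prime to u v, so it divides u + v; modulo u + v the
      value \<open>F\<close> is 5 (u v)^2, so the prime is 5.\<close>
    have "G - F = 2 * 2 * u * v * v * (u + v)"
      unfolding F_def G_def by (simp add: power2_eq_square algebra_simps)
    then have "p dvd 2 * 2 * u * v * v * (u + v)" using p by (metis dvd_diff)
    then have "p dvd 2 \<or> p dvd u + v" using nd unfolding prime_dvd_mult_iff[OF p(1)] by blast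
    moreover have "\<not> p dvd 2"
    proof
      assume "p dvd 2"
      then have "p = 2" using p(1) by (intro primes_dvd_imp_eq) simp_all
      then have "even u \<and> even v" using p(3) unfolding G_def by auto
      then show False using cop coprime_common_divisor[of u v 2] by simp
    qed
    ultimately have "p dvd u + v" by blast
    moreover have "F = (u + v) * ((u + v)^3 - 6 * u * v * (u + v)) + 5 * (u * v)\<^sup>2"
      unfolding F_def by (simp add: power2_eq_square power3_eq_cube algebra_simps)
    ultimately have "p dvd 5 * (u * v)\<^sup>2" using p(2) by (simp add: dvd_add_right_iff)
    then have "p dvd 5" using p(1) uv by (simp add: prime_dvd_mult_iff prime_dvd_power_iff)
    then have "p = 5" using p(1) by (intro primes_dvd_imp_eq) simp_all
    then show ?thesis using \<open>p dvd u + v\<close> by simp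
  qed
  have "G > 0" unfolding G_def using nz by (simp add: add_nonneg_pos)
  show ?thesis
  proof (cases "5 dvd u + v")
    case False
    then have "coprime F G" using common by (blast intro: coprime_int_primeI)
    moreover have "F \<ge> 0"
      using FG \<open>G > 0\<close> by (metis zero_le_mult_iff zero_le_power2 not_less)
    ultimately obtain y where "F = y\<^sup>2"
      using coprime_mult_eq_square FG \<open>G > 0\<close> less_imp_le by metis
    then show ?thesis using quartic1_not_square[OF cop nz] unfolding F_def by blast
  next
    case True
    then obtain k where k: "u + v = 5 * k" by blast
    then have u: "u = 5 * k - v" by simp
    \<comment> \<open>\<open>F'\<close> and \<open>G'\<close> are \<open>F\<close> / 5 and
      \<open>G\<close> / 5 for u + v = 5 k. Modulo 5 \<open>F'\<close> is (u v)^2, so 5 is not a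
      common factor any more and \<open>F\<close> is 5 times a square.\<close>
    define F' where "F' = 125 * k^4 - 30 * k\<^sup>2 * (u * v) + (u * v)\<^sup>2"
    define G' where "G' = 5 * k\<^sup>2 * (u - v)\<^sup>2 - 2 * k * (u - v) * (u * v) + (u * v)\<^sup>2"
    have F': "F = 5 * F'" unfolding F_def F'_def u by algebra
    have G': "G = 5 * G'" unfolding G_def G'_def u by algebra
    have "w\<^sup>2 = 5 * (5 * (F' * G'))" using FG unfolding F' G' by simp
    then have "5 dvd w\<^sup>2" by simp
    then have "5 dvd w" by (simp add: prime_dvd_power_iff)
    then obtain y where "w = 5 * y" by blast
    then have FG': "F' * G' = y\<^sup>2" using \<open>w\<^sup>2 = _\<close> by (simp add: power2_eq_square)
    have "coprime F' G'"
    proof (rule coprime_int_primeI)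
      fix p assume p: "prime p" "p dvd F'" "p dvd G'"
      then have "p = 5" using common F' G' by simp
      moreover have "(u * v)\<^sup>2 = F' - 5 * (25 * k^4 - 6 * k\<^sup>2 * (u * v))"
        unfolding F'_def by (simp add: algebra_simps)
      ultimately have "5 dvd (u * v)\<^sup>2" using p(2) by (metis dvd_diff dvd_triv_left)
      then have "5 dvd u * v" by (rule prime_dvd_power[rotated]) simp
      then show False using uv[of 5] G' by simp
    qed
    moreover have "G' > 0" using \<open>G > 0\<close> G' by simp
    moreover have "F' \<ge> 0"
      using FG' \<open>G' > 0\<close> by (metis zero_le_mult_iff zero_le_power2 not_less)
    ultimately obtain z where "F' = z\<^sup>2"
      using coprime_mult_eq_square FG' less_imp_le by metis
    then show ?thesis using quartic1_5_square[OF cop nz _ k] F' unfolding F_def by blast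
  qed
qed

lemma rat_square_eq_int:
  fixes q :: rat
  assumes "q\<^sup>2 = of_int n"
  obtains m where "q = of_int m" "n = m\<^sup>2"
proof -
  obtain a b where ab: "quotient_of q = (a, b)" by (cases "quotient_of q")
  then have q: "q = of_int a / of_int b" and b: "b > 0" and cop: "coprime a b"
    by (auto dest: quotient_of_div quotient_of_denom_pos quotient_of_coprime)
  have "of_int (a\<^sup>2) = (of_int (n * b\<^sup>2) :: rat)"
    using assms b unfolding q by (simp add: power_divide field_simps)
  then have "a\<^sup>2 = n * b\<^sup>2" by (simp only: of_int_eq_iff)
  then have "b dvd a\<^sup>2" by (simp add: power2_eq_square)
  then have "is_unit b" using cop by (metis coprime_common_divisor coprime_power_left_iff dvd_refl pos2)
  then have "b = 1" using b by simp
  then have "q = of_int a" using q by simp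
  moreover have "n = a\<^sup>2" using \<open>a\<^sup>2 = n * b\<^sup>2\<close> \<open>b = 1\<close> by simp
  ultimately show thesis by (rule that)
qed

text \<open>With w = t + 1/t this is t^2 (w - 3) (w + 1).\<close>

definition quartic1 :: "'a::comm_ring_1 \<Rightarrow> 'a" where
  "quartic1 t = t^4 - 2 * t^3 - t\<^sup>2 - 2 * t + 1"

text \<open>With w = t - 1/t this is t^2 ((w - 1)^2 + 4).\<close>

definition quartic2 :: "'a::comm_ring_1 \<Rightarrow> 'a" where
  "quartic2 t = t^4 - 2 * t^3 + 3 * t\<^sup>2 + 2 * t + 1"

lemma quartics_homogenize:
  fixes t :: rat
  assumes "t \<noteq> 0"
  obtains u v :: int where "coprime u v" "u * v \<noteq> 0" "t = of_int u / of_int v"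
    "quartic1 t * (of_int v)^4 = of_int ((u\<^sup>2 - 3 * (u * v) + v\<^sup>2) * (u\<^sup>2 + u * v + v\<^sup>2))"
    "quartic2 t * (of_int v)^4 = of_int ((u\<^sup>2 - u * v - v\<^sup>2)\<^sup>2 + 4 * (u * v)\<^sup>2)"
proof -
  obtain u v where uv: "quotient_of t = (u, v)" by (cases "quotient_of t")
  then have t: "t = of_int u / of_int v" and v: "v > 0" and cop: "coprime u v"
    by (auto dest: quotient_of_div quotient_of_denom_pos quotient_of_coprime)
  have u: "of_int u = t * of_int v" using t v by simp
  have "quartic1 t * (of_int v)^4 = of_int ((u\<^sup>2 - 3 * (u * v) + v\<^sup>2) * (u\<^sup>2 + u * v + v\<^sup>2))"
    unfolding quartic1_def by (simp add: u) algebra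
  moreover have "quartic2 t * (of_int v)^4 = of_int ((u\<^sup>2 - u * v - v\<^sup>2)\<^sup>2 + 4 * (u * v)\<^sup>2)"
    unfolding quartic2_def by (simp add: u) algebra
  moreover have "u * v \<noteq> 0" using assms t v by auto
  ultimately show thesis using that cop t by blast
qed

lemma quartic1_rat_square:
  fixes t y :: rat
  assumes "quartic1 t = y\<^sup>2"
  shows "t = 0"
proof (rule ccontr)
  assume "t \<noteq> 0"
  then obtain u v :: int where uv: "coprime u v" "u * v \<noteq> 0"
    "quartic1 t * (of_int v)^4 = of_int ((u\<^sup>2 - 3 * (u * v) + v\<^sup>2) * (u\<^sup>2 + u * v + v\<^sup>2))"
    by (rule quartics_homogenize)
  have "(y * (of_int v)\<^sup>2)\<^sup>2 = quartic1 t * (of_int v)^4" unfolding assms by (simp add: power_mult_distrib)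
  then obtain m where "(u\<^sup>2 - 3 * (u * v) + v\<^sup>2) * (u\<^sup>2 + u * v + v\<^sup>2) = m\<^sup>2"
    unfolding uv(3) by (rule rat_square_eq_int)
  then show False using quartic1_not_square[OF uv(1,2)] by blast
qed

lemma quartic2_rat_square:
  fixes t y :: rat
  assumes "quartic2 t = y\<^sup>2"
  shows "t = 0"
proof (rule ccontr)
  assume "t \<noteq> 0"
  then obtain u v :: int where uv: "coprime u v" "u * v \<noteq> 0"
    "quartic2 t * (of_int v)^4 = of_int ((u\<^sup>2 - u * v - v\<^sup>2)\<^sup>2 + 4 * (u * v)\<^sup>2)"
    by (rule quartics_homogenize)
  have "(y * (of_int v)\<^sup>2)\<^sup>2 = quartic2 t * (of_int v)^4" unfolding assms by (simp add: power_mult_distrib)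
  then obtain m where "(u\<^sup>2 - u * v - v\<^sup>2)\<^sup>2 + 4 * (u * v)\<^sup>2 = m\<^sup>2"
    unfolding uv(3) by (rule rat_square_eq_int)
  then show False using quartic2_not_square[OF uv(1,2)] by blast
qed

text \<open>The exception -1 is genuine: both quartics take the value 5 there.\<close>

lemma quartic_product_rat_square:
  fixes t y :: rat
  assumes "quartic1 t * quartic2 t = y\<^sup>2"
  shows "t = 0 \<or> t = -1"
proof (rule disjCI)
  assume "t \<noteq> -1"
  show "t = 0"
  proof (rule ccontr)
    assume "t \<noteq> 0"
    then obtain u v :: int where uv: "coprime u v" "u * v \<noteq> 0" "t = of_int u / of_int v"
      "quartic1 t * (of_int v)^4 = of_int ((u\<^sup>2 - 3 * (u * v) + v\<^sup>2) * (u\<^sup>2 + u * v + v\<^sup>2))"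
      "quartic2 t * (of_int v)^4 = of_int ((u\<^sup>2 - u * v - v\<^sup>2)\<^sup>2 + 4 * (u * v)\<^sup>2)"
      by (rule quartics_homogenize)
    have "(y * (of_int v)^4)\<^sup>2 = (quartic1 t * (of_int v)^4) * (quartic2 t * (of_int v)^4)"
      using assms by (simp add: power2_eq_square)
    then have "(y * (of_int v)^4)\<^sup>2 = of_int (((u\<^sup>2 - 3 * (u * v) + v\<^sup>2) * (u\<^sup>2 + u * v + v\<^sup>2)) *
        ((u\<^sup>2 - u * v - v\<^sup>2)\<^sup>2 + 4 * (u * v)\<^sup>2))"
      unfolding uv(4,5) of_int_mult .
    then obtain m where "((u\<^sup>2 - 3 * (u * v) + v\<^sup>2) * (u\<^sup>2 + u * v + v\<^sup>2)) *
        ((u\<^sup>2 - u * v - v\<^sup>2)\<^sup>2 + 4 * (u * v)\<^sup>2) = m\<^sup>2"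
      by (rule rat_square_eq_int)
    then have "u + v = 0" by (rule quartic_product_square[OF uv(1,2)])
    then have "u = - v" by simp
    then have "t = -1" using uv(2,3) by simp
    then show False using \<open>t \<noteq> -1\<close> by simp
  qed
qed

subsection \<open>Quadratic points on the two quartics\<close>

text \<open>1 and an irrational \<open>t\<close> are independent, and in dimension 2 no third
  element is independent of them.\<close>

lemma quadratic_field_span:
  fixes t y :: "'k::field_char_0"
  assumes "quadratic_field TYPE('k)" "t \<notin> \<rat>"
  obtains m n :: rat where "y = of_rat m + of_rat n * t"
proof -
  interpret vector_space "\<lambda>(q::rat) (x::'k). of_rat q * x" by (rule vector_space_of_rat)
  have dim: "dim (UNIV :: 'k set) = 2" using assms(1) unfolding quadratic_field_def .
  obtain B where B: "independent B" "span B = (UNIV :: 'k set)" "card B = 2"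
    using basis_exists[of "UNIV :: 'k set"] dim by (metis top.extremum_uniqueI)
  \<comment> \<open>\<open>card\<close> is 0 on infinite sets.\<close>
  then have "finite B" by (metis card.infinite zero_neq_numeral)
  have "t \<notin> span {1}" using assms(2) by (auto simp: span_singleton Rats_def)
  then have ind: "independent {t, 1}" by (simp add: independent_insert)
  have "y \<in> span {t, 1}"
  proof (rule ccontr)
    assume y: "y \<notin> span {t, 1}"
    then have "independent {y, t, 1}" using ind independent_insertI by blast
    then have "card {y, t, 1} \<le> card B"
      using independent_span_bound[OF \<open>finite B\<close>] B(2) by blast
    moreover have "t \<noteq> 1" using assms(2) by auto
    moreover have "y \<noteq> t" "y \<noteq> 1" using y by (auto intro: span_base)
    ultimately show False using B(3) by simp
  qed
  then obtain n where "y - of_rat n * t \<in> span {1}" by (auto simp: span_insert)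
  then obtain m where "y - of_rat n * t = of_rat m * 1" by (auto simp: span_singleton)
  then show thesis using that[of m n] by (simp add: algebra_simps)
qed

lemma rat_combination_eq_0:
  fixes t :: "'k::field_char_0"
  assumes "t \<notin> \<rat>" "of_rat m + of_rat n * t = 0"
  shows "m = 0 \<and> n = 0"
proof -
  have "n = 0"
  proof (rule ccontr)
    assume "n \<noteq> 0"
    then have "t = of_rat (- m / n)"
      using assms(2) by (simp add: of_rat_divide of_rat_minus field_simps eq_neg_iff_add_eq_0)
    then show False using assms(1) by simp
  qed
  then show ?thesis using assms(2) by simp
qed

text \<open>
  The two conclusions say that \<open>t\<close> is a root of the cubic
  \<open>t\<^sup>4 - 2t\<^sup>3 + at\<^sup>2 + bt + 1 - (t\<^sup>2 + \<alpha>t + \<beta>)\<^sup>2\<close>, reduced modulo \<open>t\<^sup>2 + Mt + N\<close>.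
\<close>

lemma quadratic_point:
  fixes t y :: "'k::field_char_0" and a b M N :: rat
  assumes "quadratic_field TYPE('k)" "t \<notin> \<rat>" and t2: "t\<^sup>2 = - (of_rat M * t + of_rat N)"
    and y: "y\<^sup>2 = t^4 - 2 * t^3 + of_rat a * t\<^sup>2 + of_rat b * t + 1"
  obtains \<alpha> \<beta> where
    "(- 2 - 2 * \<alpha>) * (M\<^sup>2 - N) - (a - \<alpha>\<^sup>2 - 2 * \<beta>) * M + (b - 2 * \<alpha> * \<beta>) = 0"
    "(- 2 - 2 * \<alpha>) * M * N - (a - \<alpha>\<^sup>2 - 2 * \<beta>) * N + (1 - \<beta>\<^sup>2) = 0"
proof -
  obtain m n :: rat where mn: "y = of_rat m + of_rat n * t"
    using quadratic_field_span[OF assms(1,2)] .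
  \<comment> \<open>Adding t^2 + M t + N = 0 to m + n t makes the linear expression for
    \<open>y\<close> a monic quadratic one, so that the quartic terms cancel.\<close>
  define \<alpha> \<beta> where ab: "\<alpha> = n + M" "\<beta> = m + N"
  define M' N' a' b' \<alpha>' \<beta>' where defs: "M' = (of_rat M :: 'k)" "N' = (of_rat N :: 'k)" "a' = (of_rat a :: 'k)"
    "b' = (of_rat b :: 'k)" "\<alpha>' = (of_rat \<alpha> :: 'k)" "\<beta>' = (of_rat \<beta> :: 'k)"
  have "y = t\<^sup>2 + \<alpha>' * t + \<beta>'"
    unfolding mn t2 defs ab by (simp add: of_rat_add algebra_simps)
  then have "((- 2 - 2 * \<alpha>') * M' * N' - (a' - \<alpha>'\<^sup>2 - 2 * \<beta>') * N' + (1 - \<beta>'\<^sup>2)) +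
      ((- 2 - 2 * \<alpha>') * (M'\<^sup>2 - N') - (a' - \<alpha>'\<^sup>2 - 2 * \<beta>') * M' + (b' - 2 * \<alpha>' * \<beta>')) * t = 0"
    using y t2 unfolding defs(1-4)[symmetric] by algebra
  then have "of_rat ((- 2 - 2 * \<alpha>) * M * N - (a - \<alpha>\<^sup>2 - 2 * \<beta>) * N + (1 - \<beta>\<^sup>2)) +
      of_rat ((- 2 - 2 * \<alpha>) * (M\<^sup>2 - N) - (a - \<alpha>\<^sup>2 - 2 * \<beta>) * M + (b - 2 * \<alpha> * \<beta>)) * t = 0"
    unfolding defs by (simp add: of_rat_add of_rat_diff of_rat_mult of_rat_power of_rat_minus)
  from rat_combination_eq_0[OF assms(2) this] show thesis using that by blast
qed

text \<open>The hypotheses say that T^2 + M T + N divides the cubic whose leading coefficient -2 - 2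
  \<alpha> is nonzero. The cofactor is linear, so its root \<tau> is rational; it is read off from
  the coefficient of T^2.\<close>

lemma third_point:
  fixes a b M N \<alpha> \<beta> :: rat
  assumes "(- 2 - 2 * \<alpha>) * (M\<^sup>2 - N) - (a - \<alpha>\<^sup>2 - 2 * \<beta>) * M + (b - 2 * \<alpha> * \<beta>) = 0"
    and "(- 2 - 2 * \<alpha>) * M * N - (a - \<alpha>\<^sup>2 - 2 * \<beta>) * N + (1 - \<beta>\<^sup>2) = 0"
    and "\<alpha> \<noteq> - 1"
  obtains \<tau> where "\<tau>^4 - 2 * \<tau>^3 + a * \<tau>\<^sup>2 + b * \<tau> + 1 = (\<tau>\<^sup>2 + \<alpha> * \<tau> + \<beta>)\<^sup>2"
    "a - \<alpha>\<^sup>2 - 2 * \<beta> = (- 2 - 2 * \<alpha>) * (M - \<tau>)"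
proof -
  have c3: "- 2 - 2 * \<alpha> \<noteq> 0" using assms(3) by auto
  define \<tau> where "\<tau> = M - (a - \<alpha>\<^sup>2 - 2 * \<beta>) / (- 2 - 2 * \<alpha>)"
  have eq: "a - \<alpha>\<^sup>2 - 2 * \<beta> = (- 2 - 2 * \<alpha>) * (M - \<tau>)" unfolding \<tau>_def using c3 by simp
  moreover have "\<tau>^4 - 2 * \<tau>^3 + a * \<tau>\<^sup>2 + b * \<tau> + 1 = (\<tau>\<^sup>2 + \<alpha> * \<tau> + \<beta>)\<^sup>2"
    using eq assms(1,2) by algebra
  ultimately show thesis using that by blast
qed

text \<open>The third point is rational, so it is at infinity or over 0. Over 0 the intercept
  \<beta> is 1 or -1, giving N = 1 or the other relation; infinity gives the other relation
  again.\<close>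

lemma quadratic_point_quartic1:
  fixes t y :: "'k::field_char_0"
  assumes "quadratic_field TYPE('k)" "t \<notin> \<rat>" "t\<^sup>2 = - (of_rat M * t + of_rat N)" "y\<^sup>2 = quartic1 t"
  shows "M * N + M + N = 0 \<or> N = 1"
proof -
  have "y\<^sup>2 = t^4 - 2 * t^3 + of_rat (-1) * t\<^sup>2 + of_rat (-2) * t + 1"
    using assms(4) unfolding quartic1_def by (simp add: of_rat_minus)
  then obtain \<alpha> \<beta> where
    eqs: "(- 2 - 2 * \<alpha>) * (M\<^sup>2 - N) - (-1 - \<alpha>\<^sup>2 - 2 * \<beta>) * M + (-2 - 2 * \<alpha> * \<beta>) = 0"
    "(- 2 - 2 * \<alpha>) * M * N - (-1 - \<alpha>\<^sup>2 - 2 * \<beta>) * N + (1 - \<beta>\<^sup>2) = 0"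
    by (rule quadratic_point[OF assms(1-3)])
  show ?thesis
  proof (cases "\<alpha> = -1")
    \<comment> \<open>here the third point of intersection is at infinity\<close>
    case True
    \<comment> \<open>The cubic drops to degree 2 and is proportional to T^2 + M T + N; coefficients
      are compared.\<close>
    have M: "(1 + \<beta>) * M = 1 - \<beta>" and N: "(1 + \<beta>) * (2 * N) = (1 + \<beta>) * (\<beta> - 1)"
      using eqs unfolding True by algebra+
    have nz: "1 + \<beta> \<noteq> 0"
    proof
      assume "1 + \<beta> = 0"
      then show False using M by simp
    qed
    then have N: "2 * N = \<beta> - 1" using N by (metis mult_left_cancel)
    have "(1 + \<beta>) * (M * N + M + N) = 0" using M N by algebra
    then show ?thesis using nz by simp
  next
    case False
    obtain \<tau> where \<tau>: "\<tau>^4 - 2 * \<tau>^3 + (-1) * \<tau>\<^sup>2 + (-2) * \<tau> + 1 = (\<tau>\<^sup>2 + \<alpha> * \<tau> + \<beta>)\<^sup>2"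
      "-1 - \<alpha>\<^sup>2 - 2 * \<beta> = (- 2 - 2 * \<alpha>) * (M - \<tau>)"
      by (rule third_point[OF eqs False])
    then have "\<tau> = 0" using quartic1_rat_square unfolding quartic1_def by simp
    then have "\<beta>\<^sup>2 = 1" and M: "-1 - \<alpha>\<^sup>2 - 2 * \<beta> = (- 2 - 2 * \<alpha>) * M" using \<tau> by simp_all
    \<comment> \<open>Since \<tau> = 0, the linear coefficient of the cubic is its leading
      coefficient times \<open>N\<close>.\<close>
    have N: "(- 2 - 2 * \<alpha>) * N = -2 - 2 * \<alpha> * \<beta>" using eqs(1) M by algebra
    have nz: "1 + \<alpha> \<noteq> 0" using False by (metis add_eq_0_iff)
    from \<open>\<beta>\<^sup>2 = 1\<close> have "\<beta> = 1 \<or> \<beta> = -1" by (simp add: power2_eq_1_iff)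
    then show ?thesis
    proof
      assume "\<beta> = 1"
      then have "(1 + \<alpha>) * N = (1 + \<alpha>) * 1" using N by algebra
      then show ?thesis using nz by simp
    next
      assume "\<beta> = -1"
      then have "(1 + \<alpha>) * (M * N + M + N) = 0"
        using M N nz by algebra
      then show ?thesis using nz by simp
    qed
  qed
qed

text \<open>As for \<open>quartic1\<close>, with the roles of \<beta> = 1 and \<beta> = -1
  exchanged.\<close>

lemma quadratic_point_quartic2:
  fixes t z :: "'k::field_char_0"
  assumes "quadratic_field TYPE('k)" "t \<notin> \<rat>" "t\<^sup>2 = - (of_rat M * t + of_rat N)" "z\<^sup>2 = quartic2 t"
  shows "M - M * N - N = 0 \<or> N = -1"
proof -
  have "z\<^sup>2 = t^4 - 2 * t^3 + of_rat 3 * t\<^sup>2 + of_rat 2 * t + 1"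
    using assms(4) unfolding quartic2_def by simp
  then obtain \<alpha> \<beta> where
    eqs: "(- 2 - 2 * \<alpha>) * (M\<^sup>2 - N) - (3 - \<alpha>\<^sup>2 - 2 * \<beta>) * M + (2 - 2 * \<alpha> * \<beta>) = 0"
    "(- 2 - 2 * \<alpha>) * M * N - (3 - \<alpha>\<^sup>2 - 2 * \<beta>) * N + (1 - \<beta>\<^sup>2) = 0"
    by (rule quadratic_point[OF assms(1-3)])
  show ?thesis
  proof (cases "\<alpha> = -1")
    \<comment> \<open>here the third point of intersection is at infinity\<close>
    case True
    have M: "(1 - \<beta>) * M = 1 + \<beta>" and N: "(1 - \<beta>) * (2 * N) = (1 - \<beta>) * (1 + \<beta>)"
      using eqs unfolding True by algebra+
    have nz: "1 - \<beta> \<noteq> 0" using M by auto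
    then have N: "2 * N = 1 + \<beta>" using N by (metis mult_left_cancel)
    have "(1 - \<beta>) * (M - M * N - N) = 0" using M N by algebra
    then show ?thesis using nz by simp
  next
    case False
    obtain \<tau> where \<tau>: "\<tau>^4 - 2 * \<tau>^3 + 3 * \<tau>\<^sup>2 + 2 * \<tau> + 1 = (\<tau>\<^sup>2 + \<alpha> * \<tau> + \<beta>)\<^sup>2"
      "3 - \<alpha>\<^sup>2 - 2 * \<beta> = (- 2 - 2 * \<alpha>) * (M - \<tau>)"
      by (rule third_point[OF eqs False])
    then have "\<tau> = 0" using quartic2_rat_square unfolding quartic2_def by simp
    then have "\<beta>\<^sup>2 = 1" and M: "3 - \<alpha>\<^sup>2 - 2 * \<beta> = (- 2 - 2 * \<alpha>) * M" using \<tau> by simp_all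
    have N: "(- 2 - 2 * \<alpha>) * N = 2 - 2 * \<alpha> * \<beta>" using eqs(1) M by algebra
    have nz: "1 + \<alpha> \<noteq> 0" using False by (metis add_eq_0_iff)
    from \<open>\<beta>\<^sup>2 = 1\<close> have "\<beta> = 1 \<or> \<beta> = -1" by (simp add: power2_eq_1_iff)
    then show ?thesis
    proof
      assume "\<beta> = 1"
      then have "(1 + \<alpha>) * (M - M * N - N) = 0"
        using M N nz by algebra
      then show ?thesis using nz by simp
    next
      assume "\<beta> = -1"
      then have "(1 + \<alpha>) * N = (1 + \<alpha>) * (-1)" using N by algebra
      then show ?thesis using nz by (metis mult_left_cancel)
    qed
  qed
qed

lemma quadratic_field_points:
  fixes t y z :: "'k::field_char_0"
  assumes "quadratic_field TYPE('k)" "y\<^sup>2 = quartic1 t" "z\<^sup>2 = quartic2 t"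
  shows "t = 0 \<or> t = -1"
proof (cases "t \<in> \<rat>")
  case False
  obtain m n :: rat where mn: "t\<^sup>2 = of_rat m + of_rat n * t"
    using quadratic_field_span[OF assms(1) False] .
  define M N where "M = - n" "N = - m"
  have t2: "t\<^sup>2 = - (of_rat M * t + of_rat N)" unfolding mn M_N_def by (simp add: of_rat_minus)
  have "M * N + M + N = 0 \<or> N = 1" "M - M * N - N = 0 \<or> N = -1"
    using quadratic_point_quartic1[OF assms(1) False t2 assms(2)]
      quadratic_point_quartic2[OF assms(1) False t2 assms(3)] .
  \<comment> \<open>The sum of the two long relations is 2 M = 0. Each of N = 1 and N = -1
    contradicts the long relation of the other quartic, and they contradict each other.\<close>
  then have "M = 0 \<and> N = 0"
  proof (elim disjE, goal_cases)
    case 1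
    have M: "M = 0" using 1 by linarith
    have "N = 0" using 1(1) unfolding M by simp
    then show ?case using M by blast
  qed simp_all
  then have "t\<^sup>2 = 0" using t2 by simp
  then show ?thesis by simp
next
  case True
  then obtain \<tau> where \<tau>: "t = of_rat \<tau>" by (auto simp: Rats_def)
  have y: "y\<^sup>2 = of_rat (quartic1 \<tau>)" and z: "z\<^sup>2 = of_rat (quartic2 \<tau>)"
    using assms(2,3) unfolding \<tau> quartic1_def quartic2_def
    by (simp_all add: of_rat_add of_rat_diff of_rat_mult of_rat_power)
  have "\<tau> = 0 \<or> \<tau> = -1"
  proof (cases "y \<in> \<rat> \<or> z \<in> \<rat>")
    case True
    then consider q where "y = of_rat q" | q where "z = of_rat q" by (auto simp: Rats_def)
    then show ?thesis
    proof cases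
      case 1
      then have "quartic1 \<tau> = q\<^sup>2" using y by (metis of_rat_eq_iff of_rat_power)
      then show ?thesis using quartic1_rat_square by blast
    next
      case 2
      then have "quartic2 \<tau> = q\<^sup>2" using z by (metis of_rat_eq_iff of_rat_power)
      then show ?thesis using quartic2_rat_square by blast
    qed
  next
    case False
    then have irr: "y \<notin> \<rat>" "z \<notin> \<rat>" by auto
    obtain m n :: rat where mn: "z = of_rat m + of_rat n * y"
      using quadratic_field_span[OF assms(1) irr(1)] .
    \<comment> \<open>As z^2 is rational and \<open>y\<close> is not, m n = 0; since
      \<open>z\<close> is irrational, m = 0, and the two values differ by the square factor
      n^2.\<close>
    have "z\<^sup>2 = of_rat m ^ 2 + of_rat n ^ 2 * y\<^sup>2 + 2 * of_rat m * of_rat n * y"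
      unfolding mn by (simp add: power2_eq_square algebra_simps)
    then have "of_rat (m\<^sup>2 + n\<^sup>2 * quartic1 \<tau> - quartic2 \<tau>) + of_rat (2 * m * n) * y = 0"
      unfolding y z by (simp add: of_rat_add of_rat_diff of_rat_mult of_rat_power)
    then have *: "m\<^sup>2 + n\<^sup>2 * quartic1 \<tau> - quartic2 \<tau> = 0" "2 * m * n = 0"
      using rat_combination_eq_0[OF irr(1)] by blast+
    have "n \<noteq> 0" using irr(2) mn by auto
    then have "m = 0" using *(2) by simp
    then have "quartic1 \<tau> * quartic2 \<tau> = (n * quartic1 \<tau>)\<^sup>2" using *(1) by (simp add: power2_eq_square)
    then show ?thesis by (rule quartic_product_rat_square)
  qed
  then show ?thesis unfolding \<tau> by (auto simp: of_rat_minus)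
qed

section \<open>From a copy of the graph to a point over both quartics\<close>

theorem theorem5p16:
  fixes c :: "'k::field_char_0"
  assumes "quadratic_field TYPE('k)"
  shows "\<not> contains_copy (with_proj (preperiodic_graph c)) (with_proj G6)"
proof
  assume "contains_copy (with_proj (preperiodic_graph c)) (with_proj G6)"
  then obtain h where inj: "inj_on h (pverts G6)"
    and arcs: "\<forall>(u, v) \<in> parcs G6. (h u, h v) \<in> parcs (preperiodic_graph c)"
    unfolding contains_copy_with_proj_iff[OF wf_preperiodic_graph wf_G6] by blast
  have arc: "(h u)\<^sup>2 + c = h v" if "(u, v) \<in> parcs G6" for u v
    using arcs that unfolding preperiodic_graph_arcs quad_map_def by auto
  have inj': "h u \<noteq> h v" if "u \<noteq> v" for u v
    using inj_onD[OF inj, of u v] that unfolding G6_def by (cases u; cases v) auto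
  define a b p q s r where defs: "a = h va" "b = h vb" "p = h vp" "q = h vq" "s = h vs" "r = h vr"
  have eqs: "a\<^sup>2 + c = a" "b\<^sup>2 + c = a" "s\<^sup>2 + c = b" "p\<^sup>2 + c = q" "q\<^sup>2 + c = p"
    "(h vpbar)\<^sup>2 + c = q" "r\<^sup>2 + c = h vpbar"
    unfolding defs by (rule arc, simp add: G6_def)+
  have neq: "b \<noteq> a" "p \<noteq> q" "h vpbar \<noteq> p" unfolding defs by (rule inj', simp)+
  \<comment> \<open>Distinct preimages of one vertex are negatives of each other.\<close>
  have "b = - a" using eqs(1,2) neq(1) by (metis add_right_cancel power2_eq_iff)
  have "h vpbar = - p" using eqs(4,6) neq(3) by (metis add_right_cancel power2_eq_iff)
  have "p\<^sup>2 - q\<^sup>2 = q - p" using eqs(4,5) by (metis add_diff_cancel_right)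
  then have "(p - q) * (p + q + 1) = 0" by (simp add: power2_eq_square algebra_simps)
  then have q: "q = - p - 1" using neq(2) by (simp add: eq_diff_eq eq_neg_iff_add_eq_0 ac_simps)
  \<comment> \<open>Eliminating \<open>c\<close> leaves the conic a^2 - a = p^2 + p + 1, that is (a
    + p)(a - p - 1) = 1, which is parametrized by its first factor.\<close>
  define t where "t = a + p"
  have a2: "a\<^sup>2 = a - c" using eqs(1) by (simp add: eq_diff_eq)
  have p2: "p\<^sup>2 = - p - 1 - c" using eqs(4) unfolding q by (simp add: eq_diff_eq)
  have s2: "s\<^sup>2 = a\<^sup>2 - 2 * a" using eqs(3) \<open>b = - a\<close> unfolding a2 by (simp add: eq_diff_eq)
  have r2: "r\<^sup>2 = p\<^sup>2 + 1" using eqs(7) \<open>h vpbar = - p\<close> unfolding p2 by (simp add: eq_diff_eq)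
  have "t * (a - p - 1) = a\<^sup>2 - p\<^sup>2 - a - p" unfolding t_def by (simp add: power2_eq_square algebra_simps)
  also have "\<dots> = 1" unfolding a2 p2 by simp
  finally have inv: "t * (a - p - 1) = 1" .
  have "t + (a - p - 1) = 2 * a - 1" unfolding t_def by simp
  then have "(2 * t * s)\<^sup>2 = quartic1 t"
    using inv s2 unfolding quartic1_def by algebra
  moreover have "t - (a - p - 1) = 2 * p + 1" unfolding t_def by simp
  then have "(2 * t * r)\<^sup>2 = quartic2 t"
    using inv r2 unfolding quartic2_def by algebra
  ultimately have "t = 0 \<or> t = -1" by (rule quadratic_field_points[OF assms])
  \<comment> \<open>The value 0 is not invertible. At -1 both factors are -1, so a = p and q = a,
    hence p = q.\<close>
  then have t: "t = -1" using inv by auto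
  then have "a = p" using inv by (simp add: algebra_simps)
  have "q = (a + p) - p" using t q unfolding t_def by simp
  then show False using neq(2) \<open>a = p\<close> by simp
qed

end
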